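(* Let $H$ and $N$ be closed subgroups of a compact group $G$ such that $N\le H$ and $N$ is normal in $G$. Then $d(H,G)\le d(H/N,G/N)\,d(N)$. Moreover, equality holds if $N\cap[H,G]$ is trivial.
   Context: For a compact group $X$, $\mu_X$ denotes its normalized Haar measure (for $N$ closed normal, $G/N$ and $H/N$ are compact groups with their own normalized Haar measures). Commutator $[x,y]=x^{-1}y^{-1}xy$; $[H,G]$ is the subgroup generated by all $[h,g]$ with $h\in H$, $g\in G$. The commutativity degree of a compact group $X$ is $d(X)=(\mu_X\times\mu_X)(\{(x,y)\in X\times X: [x,y]=1\})$. For a closed subgroup $H$ of a compact group $L$, the relative commutativity degree is $d(H,L)=(\mu_H\times\mu_L)(\{(h,g)\in H\times L: [h,g]=1\})$. *)

theory Defs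
  imports "HOL-Analysis.Analysis" "HOL-Algebra.Algebra"
begin

definition borel_of :: "'a topology \<Rightarrow> 'a measure" where
  "borel_of T = sigma (topspace T) {U. openin T U}"

definition quot_topology :: "'a topology \<Rightarrow> ('a \<Rightarrow> 'b) \<Rightarrow> 'b topology" where
  "quot_topology Y f = topology (\<lambda>V. V \<subseteq> image f (topspace Y) \<and> openin Y {x. x \<in> topspace Y \<and> f x \<in> V})"

definition compact_group :: "('a, 'b) monoid_scheme \<Rightarrow> 'a topology \<Rightarrow> bool" where
  "compact_group G T \<longleftrightarrow> group G \<and> topspace T = carrier G
     \<and> continuous_map (prod_topology T T) T (\<lambda>(x, y). x \<otimes>\<^bsub>G\<^esub> y)
     \<and> continuous_map T T (\<lambda>x. inv\<^bsub>G\<^esub> x)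
     \<and> compact_space T \<and> Hausdorff_space T"

definition normalized_haar :: "('a, 'b) monoid_scheme \<Rightarrow> 'a topology \<Rightarrow> 'a measure \<Rightarrow> bool" where
  "normalized_haar G T \<mu> \<longleftrightarrow>
     sets \<mu> = sets (borel_of T) \<and> space \<mu> = topspace T
     \<and> emeasure \<mu> (topspace T) = 1
     \<and> (\<forall>g\<in>carrier G. \<forall>A\<in>sets \<mu>. emeasure \<mu> ((\<lambda>x. g \<otimes>\<^bsub>G\<^esub> x) ` A) = emeasure \<mu> A)
     \<and> (\<forall>A\<in>sets \<mu>. emeasure \<mu> A = (INF U\<in>{U. openin T U \<and> A \<subseteq> U}. emeasure \<mu> U))
     \<and> (\<forall>U. openin T U \<longrightarrow> emeasure \<mu> U = (SUP K\<in>{K. compactin T K \<and> K \<subseteq> U}. emeasure \<mu> K))"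

definition commutator :: "('a, 'b) monoid_scheme \<Rightarrow> 'a \<Rightarrow> 'a \<Rightarrow> 'a" where
  "commutator G x y = inv\<^bsub>G\<^esub> x \<otimes>\<^bsub>G\<^esub> inv\<^bsub>G\<^esub> y \<otimes>\<^bsub>G\<^esub> x \<otimes>\<^bsub>G\<^esub> y"

definition commutator_subgroup :: "('a, 'b) monoid_scheme \<Rightarrow> 'a set \<Rightarrow> 'a set \<Rightarrow> 'a set" where
  "commutator_subgroup G H L = generate G {commutator G h l | h l. h \<in> H \<and> l \<in> L}"

(* relative commutativity degree d(H,L) w.r.t. a measure \<mu> on H \<times> L
   (the theorem takes \<mu> to be the normalized Haar measure of the compact group H \<times> L,
   i.e. the (Radon) product of the Haar measures of H and L) *)
definition rel_comm_degree :: "('a, 'b) monoid_scheme \<Rightarrow> 'a set \<Rightarrow> 'a set \<Rightarrow> ('a \<times> 'a) measure \<Rightarrow> real" where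
  "rel_comm_degree G H L \<mu> = measure \<mu> {(h, l). h \<in> H \<and> l \<in> L \<and> commutator G h l = \<one>\<^bsub>G\<^esub>}"

end

theory Submission
  imports Defs
begin

text \<open>Put \<open>P = H \<times> G\<close> and \<open>K = N \<times> N\<close>, a closed normal subgroup with quotient \<open>Q = H/N \<times> G/N\<close>. The
  measure of the set \<open>C\<close> of commuting pairs is the average over \<open>x \<in> P\<close> of the Haar measure of
  \<open>{k \<in> K. x k \<in> C}\<close>. This fibre is empty unless \<open>x\<close> is a commuting pair modulo \<open>N\<close>, and its
  measure is at most \<open>d(N)\<close>, since its slices in each coordinate are empty or cosets of centralizers.
  As the Haar measure of \<open>P\<close> projects to that of \<open>Q\<close> by uniqueness, the inequality follows. If
  \<open>N \<inter> [H,G]\<close> is trivial, then \<open>C\<close> is the full preimage of the commuting pairs of \<open>Q\<close>, which gives the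
  reverse inequality because \<open>d(N) \<le> 1\<close>.

  Borel sets of products are not product measurable here, so all averaging is done with continuous
  functions, and closed sets are reached through outer regularity and Urysohn's lemma.\<close>

section \<open>Integrals of continuous functions on compact spaces\<close>

lemma space_borel_of [simp]: "space (borel_of S) = topspace S"
  unfolding borel_of_def by (intro space_measure_of) (auto dest: openin_subset)

lemma sets_borel_of: "sets (borel_of S) = sigma_sets (topspace S) {U. openin S U}"
  unfolding borel_of_def by (intro sets_measure_of) (auto dest: openin_subset)

text \<open>Regularity is kept apart, in \<open>outer_regular\<close>, because the image measure in
  \<open>haar_integral_hom_image\<close> is only shown to be a Borel probability measure.\<close>

definition borel_prob :: "'a topology \<Rightarrow> 'a measure \<Rightarrow> bool" where
  "borel_prob S \<mu> \<longleftrightarrow> sets \<mu> = sets (borel_of S) \<and> emeasure \<mu> (space \<mu>) = 1"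

lemma borel_prob_space: "borel_prob S \<mu> \<Longrightarrow> space \<mu> = topspace S"
  unfolding borel_prob_def using sets_eq_imp_space_eq space_borel_of by metis

lemma borel_prob_finite: "borel_prob S \<mu> \<Longrightarrow> finite_measure \<mu>"
  unfolding borel_prob_def by (intro finite_measureI) simp

lemma borel_prob_openin: "borel_prob S \<mu> \<Longrightarrow> openin S U \<Longrightarrow> U \<in> sets \<mu>"
  unfolding borel_prob_def by (simp add: sets_borel_of sigma_sets.Basic)

lemma borel_prob_closedin:
  assumes "borel_prob S \<mu>" "closedin S C"
  shows "C \<in> sets \<mu>"
proof -
  have "space \<mu> - (topspace S - C) \<in> sets \<mu>"
    using assms by (intro sets.compl_sets borel_prob_openin) auto
  moreover have "space \<mu> - (topspace S - C) = C"
    using assms borel_prob_space closedin_subset by blast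
  ultimately show ?thesis by simp
qed

lemma continuous_map_measurable:
  assumes "continuous_map S Y f" "borel_prob S \<mu>" "sets \<nu> = sets (borel_of Y)"
  shows "f \<in> measurable \<mu> \<nu>"
proof (rule measurable_sigma_sets)
  show "sets \<nu> = sigma_sets (topspace Y) {U. openin Y U}"
    using assms by (simp add: sets_borel_of)
  show "{U. openin Y U} \<subseteq> Pow (topspace Y)" by (auto dest: openin_subset)
  show "f \<in> space \<mu> \<rightarrow> topspace Y"
    using assms by (auto simp: borel_prob_space continuous_map_def)
  fix U assume "U \<in> {U. openin Y U}"
  then have "openin S {x \<in> topspace S. f x \<in> U}"
    using assms(1) by (simp add: continuous_map_def)
  moreover have "{x \<in> topspace S. f x \<in> U} = f -` U \<inter> space \<mu>"
    using borel_prob_space[OF assms(2)] by auto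
  ultimately show "f -` U \<inter> space \<mu> \<in> sets \<mu>"
    using borel_prob_openin[OF assms(2)] by simp
qed

lemma continuous_map_borel_measurable:
  assumes "continuous_map S euclideanreal f" "borel_prob S \<mu>"
  shows "f \<in> borel_measurable \<mu>"
  using assms by (rule continuous_map_measurable) (simp add: borel_of_def borel_def)

lemma continuous_map_compact_bounded:
  assumes "compact_space S" "continuous_map S euclideanreal f"
  obtains B where "\<And>x. x \<in> topspace S \<Longrightarrow> \<bar>f x\<bar> \<le> B"
proof -
  have "compact (f ` topspace S)"
    using assms by (metis compact_space_def compactin_euclidean_iff image_compactin)
  then have "bounded (f ` topspace S)" by (rule compact_imp_bounded)
  then show ?thesis using that by (auto simp: bounded_iff)
qed

lemma integrable_continuous_map:
  assumes "compact_space S" "continuous_map S euclideanreal f" "borel_prob S \<mu>"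
  shows "integrable \<mu> f"
proof -
  obtain B where "\<And>x. x \<in> topspace S \<Longrightarrow> \<bar>f x\<bar> \<le> B"
    using continuous_map_compact_bounded assms by blast
  then show ?thesis
    using assms by (intro finite_measure.integrable_const_bound[where B=B] borel_prob_finite
        continuous_map_borel_measurable AE_I2) (auto simp: borel_prob_space)
qed

lemma integral_const_borel_prob: "borel_prob S \<mu> \<Longrightarrow> (\<integral>x. c \<partial>\<mu>) = (c::real)"
  by (simp add: borel_prob_def measure_def)

text \<open>The Borel sets of a product of non-metrizable spaces need not be product measurable, so
  Fubini is only available for continuous functions. They are product measurable because, by
  compactness, a finite union of open rectangles fits between \<open>{f \<ge> c}\<close> and \<open>{f > a}\<close> for \<open>a < c\<close>.\<close>

lemma continuous_map_prod_borel_measurable: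
  assumes S: "compact_space S" "borel_prob S \<mu>" and Y: "compact_space Y" "borel_prob Y \<nu>"
    and f: "continuous_map (prod_topology S Y) euclideanreal f"
  shows "f \<in> borel_measurable (\<mu> \<Otimes>\<^sub>M \<nu>)"
proof (rule borel_measurableI_greater)
  fix a :: real
  have top: "topspace (prod_topology S Y) = space (\<mu> \<Otimes>\<^sub>M \<nu>)"
    using S Y by (simp add: space_pair_measure borel_prob_space)
  define between where "between c W \<longleftrightarrow> W \<in> sets (\<mu> \<Otimes>\<^sub>M \<nu>)
      \<and> {p \<in> space (\<mu> \<Otimes>\<^sub>M \<nu>). f p \<ge> c} \<subseteq> W \<and> W \<subseteq> {p \<in> space (\<mu> \<Otimes>\<^sub>M \<nu>). f p > a}" for c W
  have "\<exists>W. between c W" if "a < c" for c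
  proof -
    let ?C = "{p \<in> topspace (prod_topology S Y). f p \<in> {c..}}"
    let ?O = "{p \<in> topspace (prod_topology S Y). f p \<in> {a<..}}"
    let ?R = "{U \<times> V | U V. openin S U \<and> openin Y V \<and> U \<times> V \<subseteq> ?O}"
    have "closedin (prod_topology S Y) ?C"
      by (rule closedin_continuous_map_preimage[OF f]) simp
    then have C: "compactin (prod_topology S Y) ?C"
      using S Y by (intro closedin_compact_space) (auto simp: compact_space_prod_topology)
    have "openin (prod_topology S Y) ?O"
      by (rule openin_continuous_map_preimage[OF f]) simp
    then have O: "\<exists>U V. openin S U \<and> openin Y V \<and> x \<in> U \<and> y \<in> V \<and> U \<times> V \<subseteq> ?O"
      if "(x, y) \<in> ?O" for x y
      using that unfolding openin_prod_topology_alt by blast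
    have "?C \<subseteq> \<Union>?R"
    proof
      fix p assume p: "p \<in> ?C"
      obtain x y where xy: "p = (x, y)" by (cases p)
      have "(x, y) \<in> ?O" using p xy that by auto
      from O[OF this] obtain U V where "openin S U" "openin Y V" "x \<in> U" "y \<in> V" "U \<times> V \<subseteq> ?O"
        by blast
      then have "U \<times> V \<in> ?R" "p \<in> U \<times> V" using xy by auto
      then show "p \<in> \<Union>?R" by (rule UnionI)
    qed
    moreover have "\<And>U. U \<in> ?R \<Longrightarrow> openin (prod_topology S Y) U"
      by (auto simp: openin_prod_Times_iff)
    ultimately obtain F where F: "finite F" "F \<subseteq> ?R" "?C \<subseteq> \<Union>F"
      using compactinD[OF C] by meson
    have "\<Union>F \<in> sets (\<mu> \<Otimes>\<^sub>M \<nu>)"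
    proof (rule sets.finite_Union[OF F(1)], rule subsetI)
      fix R assume "R \<in> F"
      then obtain U V where "R = U \<times> V" "openin S U" "openin Y V" using F(2) by blast
      then show "R \<in> sets (\<mu> \<Otimes>\<^sub>M \<nu>)"
        using borel_prob_openin[OF S(2)] borel_prob_openin[OF Y(2)] by (simp add: pair_measureI)
    qed
    moreover have "\<Union>F \<subseteq> ?O" using F(2) by blast
    ultimately show ?thesis
      using F(3) unfolding between_def top[symmetric] by (intro exI[of _ "\<Union>F"]) auto
  qed
  then obtain W where "\<And>c. a < c \<Longrightarrow> between c (W c)" by metis
  then have W: "\<And>c. a < c \<Longrightarrow> W c \<in> sets (\<mu> \<Otimes>\<^sub>M \<nu>)"
    "\<And>c. a < c \<Longrightarrow> {p \<in> space (\<mu> \<Otimes>\<^sub>M \<nu>). f p \<ge> c} \<subseteq> W c"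
    "\<And>c. a < c \<Longrightarrow> W c \<subseteq> {p \<in> space (\<mu> \<Otimes>\<^sub>M \<nu>). f p > a}"
    unfolding between_def by blast+
  \<comment> \<open>Each \<open>W c\<close> is squeezed between \<open>{f \<ge> c}\<close> and
    \<open>{f > a}\<close>, so the thresholds \<open>a + 1/(n+1)\<close> exhaust the strict
    superlevel set by countably many measurable sets.\<close>
  have "{p \<in> space (\<mu> \<Otimes>\<^sub>M \<nu>). a < f p} = (\<Union>n. W (a + inverse (real (Suc n))))"
  proof (intro equalityI subsetI)
    fix p assume p: "p \<in> {p \<in> space (\<mu> \<Otimes>\<^sub>M \<nu>). a < f p}"
    then obtain n where "inverse (real (Suc n)) < f p - a"
      using reals_Archimedean[of "f p - a"] by auto
    then have "p \<in> W (a + inverse (real (Suc n)))"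
      using p W(2)[of "a + inverse (real (Suc n))"] by auto
    then show "p \<in> (\<Union>n. W (a + inverse (real (Suc n))))" by blast
  next
    fix p assume "p \<in> (\<Union>n. W (a + inverse (real (Suc n))))"
    then obtain n where "p \<in> W (a + inverse (real (Suc n)))" by blast
    then show "p \<in> {p \<in> space (\<mu> \<Otimes>\<^sub>M \<nu>). a < f p}"
      using W(3)[of "a + inverse (real (Suc n))"] by auto
  qed
  also have "\<dots> \<in> sets (\<mu> \<Otimes>\<^sub>M \<nu>)"
    using W(1) by (intro sets.countable_UN) auto
  finally show "{p \<in> space (\<mu> \<Otimes>\<^sub>M \<nu>). a < f p} \<in> sets (\<mu> \<Otimes>\<^sub>M \<nu>)" .
qed

lemma Fubini_continuous_map:
  assumes S: "compact_space S" "borel_prob S \<mu>" and Y: "compact_space Y" "borel_prob Y \<nu>"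
    and f: "continuous_map (prod_topology S Y) euclideanreal (\<lambda>(x, y). f x y)"
  shows "(\<integral>y. (\<integral>x. f x y \<partial>\<mu>) \<partial>\<nu>) = (\<integral>x. (\<integral>y. f x y \<partial>\<nu>) \<partial>\<mu>)"
proof -
  interpret \<mu>: finite_measure \<mu> using S by (simp add: borel_prob_finite)
  interpret \<nu>: finite_measure \<nu> using Y by (simp add: borel_prob_finite)
  interpret pair_sigma_finite \<mu> \<nu> ..
  have "finite_measure (\<mu> \<Otimes>\<^sub>M \<nu>)"
    by (intro finite_measure_pair_measure) unfold_locales
  moreover obtain B where "\<And>p. p \<in> topspace (prod_topology S Y) \<Longrightarrow> \<bar>(\<lambda>(x, y). f x y) p\<bar> \<le> B"
    using continuous_map_compact_bounded[OF _ f] S Y by (metis compact_space_prod_topology)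
  ultimately have "integrable (\<mu> \<Otimes>\<^sub>M \<nu>) (\<lambda>(x, y). f x y)"
    using S Y continuous_map_prod_borel_measurable[OF S Y f]
    by (intro finite_measure.integrable_const_bound[where B=B] AE_I2)
       (auto simp: space_pair_measure borel_prob_space)
  then show ?thesis by (rule Fubini_integral)
qed

text \<open>By the tube lemma, compactness of \<open>Y\<close> makes the continuity of
  \<open>f\<close> at \<open>x0\<close> uniform in \<open>y\<close>; integration against a measure
  of mass one then preserves the estimate.\<close>

lemma continuous_map_integral:
  assumes Y: "compact_space Y" "borel_prob Y \<nu>"
    and f: "continuous_map (prod_topology S Y) euclideanreal (\<lambda>(x, y). f x y)"
  shows "continuous_map S euclideanreal (\<lambda>x. \<integral>y. f x y \<partial>\<nu>)"
proof -
  have slice: "continuous_map Y euclideanreal (f x)" if "x \<in> topspace S" for x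
    using continuous_map_compose[OF _ f, of Y "\<lambda>y. (x, y)"] that
    by (simp add: continuous_map_pairedI o_def)
  have "\<exists>U. openin S U \<and> x0 \<in> U \<and> (\<forall>x\<in>U. dist (\<integral>y. f x0 y \<partial>\<nu>) (\<integral>y. f x y \<partial>\<nu>) < e)"
    if x0: "x0 \<in> topspace S" and e: "e > 0" for x0 e
  proof -
    let ?g = "\<lambda>(x, y). f x y - f x0 y"
    have "continuous_map (prod_topology S Y) euclideanreal (\<lambda>p. f x0 (snd p))"
      using continuous_map_compose[OF continuous_map_snd slice[OF x0]] by (simp add: o_def)
    then have g: "continuous_map (prod_topology S Y) euclideanreal ?g"
      using continuous_map_diff[OF f] by (simp add: case_prod_unfold)
    \<comment> \<open>The margin is \<open>e/2\<close> because integration yields only a weak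
      inequality, whereas the conclusion is strict.\<close>
    let ?W = "{p \<in> topspace (prod_topology S Y). ?g p \<in> {- (e/2) <..< e/2}}"
    have "openin (prod_topology S Y) ?W"
      by (rule openin_continuous_map_preimage[OF g]) simp
    moreover have "{x0} \<times> topspace Y \<subseteq> ?W" using x0 e by auto
    ultimately obtain U V where U: "openin S U" "x0 \<in> U" "topspace Y \<subseteq> V" "U \<times> V \<subseteq> ?W"
      using tube_lemma_right[of S Y ?W "topspace Y" x0] x0 Y(1) unfolding compact_space_def by blast
    have "dist (\<integral>y. f x0 y \<partial>\<nu>) (\<integral>y. f x y \<partial>\<nu>) < e" if "x \<in> U" for x
    proof -
      have x: "x \<in> topspace S" using U(1) that openin_subset by blast
      have d: "\<bar>f x y - f x0 y\<bar> \<le> e/2" if "y \<in> topspace Y" for y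
      proof -
        have "(x, y) \<in> ?W" using U(3,4) \<open>x \<in> U\<close> that by blast
        then have "- (e/2) < f x y - f x0 y" "f x y - f x0 y < e/2" by auto
        then show ?thesis by linarith
      qed
      have i: "integrable \<nu> (f x)" "integrable \<nu> (f x0)"
        using integrable_continuous_map[OF Y(1) _ Y(2)] slice x x0 by auto
      have "\<bar>(\<integral>y. f x y \<partial>\<nu>) - (\<integral>y. f x0 y \<partial>\<nu>)\<bar> = \<bar>\<integral>y. f x y - f x0 y \<partial>\<nu>\<bar>"
        using i by simp
      also have "\<dots> \<le> (\<integral>y. \<bar>f x y - f x0 y\<bar> \<partial>\<nu>)" by (rule integral_abs_bound)
      also have "\<dots> \<le> (\<integral>y. e/2 \<partial>\<nu>)"
        using i d Y(2) by (intro integral_mono)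
          (auto simp: borel_prob_space borel_prob_finite finite_measure.integrable_const)
      also have "\<dots> = e/2" by (rule integral_const_borel_prob[OF Y(2)])
      finally show ?thesis using e by (simp add: dist_real_def abs_minus_commute)
    qed
    then show ?thesis using U by blast
  qed
  then show ?thesis
    using Met_TC.continuous_map_to_metric[of S "\<lambda>x. \<integral>y. f x y \<partial>\<nu>"]
    by (simp add: Met_TC.mball_def)
qed

section \<open>Passing between measures of sets and integrals of continuous functions\<close>

lemma Urysohn_compact_Hausdorff:
  fixes S :: "'a topology"
  assumes "compact_space S" "Hausdorff_space S" "closedin S A" "closedin S B" "disjnt A B"
  shows "\<exists>f::'a \<Rightarrow> real. continuous_map S euclideanreal f \<and> (\<forall>x\<in>topspace S. 0 \<le> f x)
    \<and> (\<forall>x\<in>topspace S. f x \<le> 1) \<and> (\<forall>x\<in>A. f x = 1) \<and> (\<forall>x\<in>B. f x = 0)"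
proof -
  have "normal_space S"
    using assms compact_Hausdorff_or_regular_imp_normal_space by blast
  then obtain f where f: "continuous_map S (top_of_set {0..1::real}) f" "f ` B \<subseteq> {0}" "f ` A \<subseteq> {1}"
    using Urysohn_lemma[of S B A 0 1] assms by (auto simp: disjnt_sym)
  then show ?thesis
    by (intro exI[of _ f]) (auto simp: continuous_map_in_subtopology image_subset_iff Pi_iff)
qed

text \<open>One half of a pair with \<open>integral_le_measure\<close>: a Urysohn function equal to
  one on a closed set and vanishing off an open superset of nearly the same measure has its integral
  trapped between the two measures.\<close>

lemma measure_le_integral:
  assumes "compact_space S" "borel_prob S \<mu>" "continuous_map S euclideanreal f" "E \<in> sets \<mu>"
    and "\<And>x. x \<in> topspace S \<Longrightarrow> 0 \<le> f x" "\<And>x. x \<in> E \<Longrightarrow> 1 \<le> f x"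
  shows "measure \<mu> E \<le> (\<integral>x. f x \<partial>\<mu>)"
proof -
  interpret finite_measure \<mu> using assms by (simp add: borel_prob_finite)
  have "measure \<mu> E = (\<integral>x. indicator E x \<partial>\<mu>)"
    using assms sets.sets_into_space by (simp add: Int_absorb2)
  also have "\<dots> \<le> (\<integral>x. f x \<partial>\<mu>)"
    using assms integrable_continuous_map[of S f \<mu>]
    by (intro integral_mono integrable_real_indicator)
      (auto simp: borel_prob_space less_top[symmetric] split: split_indicator)
  finally show ?thesis .
qed

lemma integral_le_measure:
  assumes "compact_space S" "borel_prob S \<mu>" "continuous_map S euclideanreal f" "U \<in> sets \<mu>"
    and "\<And>x. x \<in> topspace S \<Longrightarrow> f x \<le> 1" "\<And>x. x \<in> topspace S - U \<Longrightarrow> f x \<le> 0"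
  shows "(\<integral>x. f x \<partial>\<mu>) \<le> measure \<mu> U"
proof -
  interpret finite_measure \<mu> using assms by (simp add: borel_prob_finite)
  have "(\<integral>x. f x \<partial>\<mu>) \<le> (\<integral>x. indicator U x \<partial>\<mu>)"
    using assms integrable_continuous_map[of S f \<mu>]
    by (intro integral_mono integrable_real_indicator)
      (auto simp: borel_prob_space less_top[symmetric] split: split_indicator)
  also have "\<dots> = measure \<mu> U"
    using assms sets.sets_into_space by (simp add: Int_absorb2)
  finally show ?thesis .
qed

definition outer_regular :: "'a topology \<Rightarrow> 'a measure \<Rightarrow> bool" where
  "outer_regular S \<mu> \<longleftrightarrow>
     (\<forall>A\<in>sets \<mu>. emeasure \<mu> A = (INF U\<in>{U. openin S U \<and> A \<subseteq> U}. emeasure \<mu> U))"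

lemma outer_regularE:
  assumes "outer_regular S \<mu>" "borel_prob S \<mu>" "A \<in> sets \<mu>" "e > 0"
  obtains U where "openin S U" "A \<subseteq> U" "measure \<mu> U < measure \<mu> A + e"
proof -
  interpret finite_measure \<mu> using assms by (simp add: borel_prob_finite)
  have "(INF U\<in>{U. openin S U \<and> A \<subseteq> U}. emeasure \<mu> U) < ennreal (measure \<mu> A + e)"
    using assms unfolding outer_regular_def
    by (metis emeasure_eq_measure ennreal_lessI less_add_same_cancel1 add_nonneg_pos measure_nonneg)
  then obtain U where "openin S U" "A \<subseteq> U" "emeasure \<mu> U < ennreal (measure \<mu> A + e)"
    by (auto simp: INF_less_iff)
  then show ?thesis
    using that by (simp add: emeasure_eq_measure ennreal_less_iff)
qed

text \<open>Fubini for continuous functions puts the integral over \<open>K\<close> outside, where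
  \<open>inv\<close> makes the inner integral independent of \<open>k\<close>. In the applications
  \<open>\<theta> x k\<close> is a right translate of \<open>x\<close>.\<close>

lemma integral_average:
  assumes S: "compact_space S" "borel_prob S \<mu>"
    and K: "compact_space K" "borel_prob K \<nu>"
    and \<theta>: "continuous_map (prod_topology S K) S (\<lambda>(x, k). \<theta> x k)"
    and inv: "\<And>k. k \<in> topspace K \<Longrightarrow> (\<integral>x. f (\<theta> x k) \<partial>\<mu>) = (\<integral>x. f x \<partial>\<mu>)"
    and f: "continuous_map S euclideanreal f"
  shows "(\<integral>x. (\<integral>k. f (\<theta> x k) \<partial>\<nu>) \<partial>\<mu>) = (\<integral>x. f x \<partial>\<mu>)"
proof -
  have "continuous_map (prod_topology S K) euclideanreal (\<lambda>(x, k). f (\<theta> x k))"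
    using continuous_map_compose[OF \<theta> f] by (simp add: o_def case_prod_unfold)
  then have "(\<integral>x. (\<integral>k. f (\<theta> x k) \<partial>\<nu>) \<partial>\<mu>) = (\<integral>k. (\<integral>x. f (\<theta> x k) \<partial>\<mu>) \<partial>\<nu>)"
    using Fubini_continuous_map[OF S K] by simp
  also have "\<dots> = (\<integral>k. (\<integral>x. f x \<partial>\<mu>) \<partial>\<nu>)"
    using K by (intro Bochner_Integration.integral_cong refl inv) (simp add: borel_prob_space)
  finally show ?thesis using integral_const_borel_prob[OF K(2)] by simp
qed

text \<open>A substitute for Fubini's theorem on closed sets. Pointwise in \<open>x\<close>, outer regularity of \<open>\<nu>\<close>
  and Urysohn's lemma give a continuous majorant of the indicator of \<open>E\<close> whose average over \<open>K\<close> is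
  below \<open>F x + e\<close>; it stays so near \<open>x\<close>, and finitely many of these majorants are multiplied.\<close>

lemma measure_le_integral_average:
  assumes S: "compact_space S" "Hausdorff_space S" "borel_prob S \<mu>"
    and K: "compact_space K" "borel_prob K \<nu>" "outer_regular K \<nu>"
    and \<theta>: "continuous_map (prod_topology S K) S (\<lambda>(x, k). \<theta> x k)"
    and inv: "\<And>f k. continuous_map S euclideanreal f \<Longrightarrow> k \<in> topspace K \<Longrightarrow>
                (\<integral>x. f (\<theta> x k) \<partial>\<mu>) = (\<integral>x. f x \<partial>\<mu>)"
    and E: "closedin S E" and F: "continuous_map S euclideanreal F"
    and le: "\<And>x. x \<in> topspace S \<Longrightarrow> measure \<nu> {k \<in> topspace K. \<theta> x k \<in> E} \<le> F x"
  shows "measure \<mu> E \<le> (\<integral>x. F x \<partial>\<mu>)"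
proof (rule field_le_epsilon)
  fix e :: real assume e: "e > 0"
  define good where "good x f \<longleftrightarrow> continuous_map S euclideanreal f
      \<and> (\<forall>y\<in>topspace S. 0 \<le> f y \<and> f y \<le> 1) \<and> (\<forall>y\<in>E. f y = 1)
      \<and> (\<integral>k. f (\<theta> x k) \<partial>\<nu>) < F x + e" for x f
  have comp: "continuous_map (prod_topology S K) euclideanreal (\<lambda>(x, k). f (\<theta> x k))"
    if "continuous_map S euclideanreal f" for f
    using continuous_map_compose[OF \<theta> that] by (simp add: o_def case_prod_unfold)
  have \<theta>x: "continuous_map K S (\<theta> x)" if "x \<in> topspace S" for x
    using continuous_map_compose[OF _ \<theta>, of K "\<lambda>k. (x, k)"] that
    by (simp add: continuous_map_pairedI o_def)
  have "\<exists>f. good x f" if x: "x \<in> topspace S" for x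
  proof -
    let ?E = "{k \<in> topspace K. \<theta> x k \<in> E}"
    have "closedin K ?E"
      using closedin_continuous_map_preimage[OF \<theta>x[OF x] E] .
    then obtain U where U: "openin K U" "?E \<subseteq> U" "measure \<nu> U < measure \<nu> ?E + e"
      using outer_regularE[OF K(3,2) _ e] borel_prob_closedin[OF K(2)] by blast
    \<comment> \<open>Closedness of the image lets Urysohn's lemma separate it from
      \<open>E\<close>; the resulting \<open>f\<close> satisfies \<open>f (\<theta> x k) = 0\<close>
      for \<open>k\<close> outside \<open>U\<close>, so its average is at most the measure of
      \<open>U\<close>.\<close>
    have "compactin K (topspace K - U)"
      using U(1) K(1) by (intro closedin_compact_space) auto
    then have cl: "closedin S (\<theta> x ` (topspace K - U))"
      using S(2) \<theta>x[OF x] image_compactin compactin_imp_closedin by metis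
    have dj: "disjnt E (\<theta> x ` (topspace K - U))"
      using U(2) by (auto simp: disjnt_iff)
    obtain f where f: "continuous_map S euclideanreal f"
      "\<forall>y\<in>topspace S. 0 \<le> f y" "\<forall>y\<in>topspace S. f y \<le> 1"
      "\<forall>y\<in>E. f y = 1" "\<forall>y\<in>\<theta> x ` (topspace K - U). f y = 0"
      using Urysohn_compact_Hausdorff[OF S(1,2) E cl dj] by blast
    have "continuous_map K euclideanreal (\<lambda>k. f (\<theta> x k))"
      using continuous_map_compose[OF \<theta>x[OF x] f(1)] by (simp add: o_def)
    then have "(\<integral>k. f (\<theta> x k) \<partial>\<nu>) \<le> measure \<nu> U"
      using f(3,5) \<theta>x[OF x] borel_prob_openin[OF K(2) U(1)]
      by (intro integral_le_measure[OF K(1,2)]) (auto simp: continuous_map_def Pi_iff)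
    also have "\<dots> < F x + e" using U(3) le[OF x] by linarith
    finally show ?thesis using f unfolding good_def by (intro exI[of _ f]) simp
  qed
  then obtain f where f: "\<And>x. x \<in> topspace S \<Longrightarrow> good x (f x)" by metis
  \<comment> \<open>The strict inequality in \<open>good\<close> persists on an open set, since both
    of its sides depend continuously on the base point.\<close>
  define V where "V x = {y \<in> topspace S. F y + e - (\<integral>k. f x (\<theta> y k) \<partial>\<nu>) \<in> {0<..}}" for x
  have V: "openin S (V x)" "x \<in> V x" if x: "x \<in> topspace S" for x
  proof -
    have "continuous_map S euclideanreal (\<lambda>y. \<integral>k. f x (\<theta> y k) \<partial>\<nu>)"
      using f[OF x] unfolding good_def by (intro continuous_map_integral[OF K(1,2)] comp) blast
    then have "continuous_map S euclideanreal (\<lambda>y. F y + e - (\<integral>k. f x (\<theta> y k) \<partial>\<nu>))"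
      by (intro continuous_map_diff continuous_map_add F) auto
    then show "openin S (V x)"
      unfolding V_def by (rule openin_continuous_map_preimage) simp
    show "x \<in> V x" using f[OF x] x by (auto simp: V_def good_def)
  qed
  have "compactin S (topspace S)" using S(1) by (simp add: compact_space_def)
  moreover have "\<And>W. W \<in> V ` topspace S \<Longrightarrow> openin S W" using V(1) by blast
  moreover have "topspace S \<subseteq> \<Union>(V ` topspace S)" using V(2) by blast
  ultimately obtain \<F> where "finite \<F>" "\<F> \<subseteq> V ` topspace S" "topspace S \<subseteq> \<Union>\<F>"
    using compactinD[of S "topspace S" "V ` topspace S"] by auto
  then obtain Z where Z: "finite Z" "Z \<subseteq> topspace S" "topspace S \<subseteq> \<Union>(V ` Z)"
    by (metis finite_subset_image)
  \<comment> \<open>Factors in \<open>[0,1]\<close> make the product lie below each of them, while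
    it remains one on \<open>E\<close>; a single function thus inherits all the local
    bounds.\<close>
  define g where "g y = (\<Prod>z\<in>Z. f z y)" for y
  have fZ: "continuous_map S euclideanreal (f z)" "\<And>y. y \<in> topspace S \<Longrightarrow> 0 \<le> f z y"
    "\<And>y. y \<in> topspace S \<Longrightarrow> f z y \<le> 1" "\<And>y. y \<in> E \<Longrightarrow> f z y = 1" if "z \<in> Z" for z
    using f[of z] that Z(2) unfolding good_def by blast+
  have g: "continuous_map S euclideanreal g"
    unfolding g_def using Z(1) fZ(1) by (intro continuous_map_prod) auto
  have g_le: "g y \<le> f z y" if "y \<in> topspace S" "z \<in> Z" for y z
  proof -
    have "g y = f z y * (\<Prod>z\<in>Z - {z}. f z y)"
      unfolding g_def using Z(1) that by (simp add: prod.remove)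
    also have "\<dots> \<le> f z y * 1"
      using that fZ by (intro mult_left_mono prod_le_1) auto
    finally show ?thesis by simp
  qed
  have "measure \<mu> E \<le> (\<integral>x. g x \<partial>\<mu>)"
    using fZ E by (intro measure_le_integral[OF S(1,3) g] borel_prob_closedin[OF S(3)])
      (auto simp: g_def intro!: prod_nonneg)
  \<comment> \<open>Invariance replaces \<open>g\<close> by its averages over \<open>K\<close>,
    which are estimated at each point by the factor whose neighbourhood contains that point.\<close>
  also have "\<dots> = (\<integral>x. (\<integral>k. g (\<theta> x k) \<partial>\<nu>) \<partial>\<mu>)"
    using integral_average[OF S(1,3) K(1,2) \<theta> inv g] g by simp
  also have "\<dots> \<le> (\<integral>x. F x + e \<partial>\<mu>)"
  proof (rule integral_mono)
    show "integrable \<mu> (\<lambda>x. \<integral>k. g (\<theta> x k) \<partial>\<nu>)"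
      by (intro integrable_continuous_map[OF S(1) _ S(3)] continuous_map_integral[OF K(1,2)] comp g)
    show "integrable \<mu> (\<lambda>x. F x + e)"
      by (intro integrable_continuous_map[OF S(1) _ S(3)] continuous_map_add F) auto
    fix x assume "x \<in> space \<mu>"
    then have x: "x \<in> topspace S" using borel_prob_space[OF S(3)] by simp
    then obtain z where z: "z \<in> Z" "x \<in> V z" using Z(3) by blast
    have c: "continuous_map K euclideanreal (\<lambda>k. h (\<theta> x k))"
      if "continuous_map S euclideanreal h" for h
      using continuous_map_compose[OF \<theta>x[OF x] that] by (simp add: o_def)
    have "(\<integral>k. g (\<theta> x k) \<partial>\<nu>) \<le> (\<integral>k. f z (\<theta> x k) \<partial>\<nu>)"
      using g_le[OF _ z(1)] \<theta>x[OF x] borel_prob_space[OF K(2)]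
      by (intro integral_mono integrable_continuous_map[OF K(1) _ K(2)] c g fZ(1)[OF z(1)])
        (auto simp: continuous_map_def Pi_iff)
    also have "\<dots> \<le> F x + e" using z(2) unfolding V_def by simp
    finally show "(\<integral>k. g (\<theta> x k) \<partial>\<nu>) \<le> F x + e" .
  qed
  also have "\<dots> = (\<integral>x. F x \<partial>\<mu>) + (\<integral>x. e \<partial>\<mu>)"
    using S F by (intro Bochner_Integration.integral_add integrable_continuous_map[OF S(1) _ S(3)]) auto
  also have "\<dots> = (\<integral>x. F x \<partial>\<mu>) + e" using integral_const_borel_prob[OF S(3)] by simp
  finally show "measure \<mu> E \<le> (\<integral>x. F x \<partial>\<mu>) + e" .
qed

section \<open>Invariant integrals on compact groups\<close>

text \<open>Invariance is tested against continuous functions only: this is the class for which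
  Fubini is available, and it is the form in which uniqueness is proved and image measures are
  compared.\<close>

definition haar_integral :: "('a, 'b) monoid_scheme \<Rightarrow> 'a topology \<Rightarrow> 'a measure \<Rightarrow> bool" where
  "haar_integral G T \<mu> \<longleftrightarrow> borel_prob T \<mu>
     \<and> (\<forall>f g. continuous_map T euclideanreal f \<longrightarrow> g \<in> carrier G \<longrightarrow>
          (\<integral>x. f (g \<otimes>\<^bsub>G\<^esub> x) \<partial>\<mu>) = (\<integral>x. f x \<partial>\<mu>))"

lemma haar_integral_left:
  assumes "haar_integral G T \<mu>" "continuous_map T euclideanreal f" "g \<in> carrier G"
  shows "(\<integral>x. f (g \<otimes>\<^bsub>G\<^esub> x) \<partial>\<mu>) = (\<integral>x. f x \<partial>\<mu>)"
  using assms unfolding haar_integral_def by blast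

lemma compact_groupD:
  assumes "compact_group G T"
  shows "group G" "topspace T = carrier G"
    "continuous_map (prod_topology T T) T (\<lambda>(x, y). x \<otimes>\<^bsub>G\<^esub> y)"
    "continuous_map T T (\<lambda>x. inv\<^bsub>G\<^esub> x)" "compact_space T" "Hausdorff_space T"
  using assms unfolding compact_group_def by auto

lemma continuous_map_group_mult:
  assumes "compact_group G T" "continuous_map S T f" "continuous_map S T g"
  shows "continuous_map S T (\<lambda>x. f x \<otimes>\<^bsub>G\<^esub> g x)"
  using continuous_map_compose[OF _ compact_groupD(3)[OF assms(1)], of S "\<lambda>x. (f x, g x)"] assms
  by (simp add: continuous_map_pairedI o_def)

lemma continuous_map_group_inv:
  assumes "compact_group G T" "continuous_map S T f"
  shows "continuous_map S T (\<lambda>x. inv\<^bsub>G\<^esub> (f x))"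
  using continuous_map_compose[OF assms(2) compact_groupD(4)[OF assms(1)]] by (simp add: o_def)

lemma continuous_map_left_translation:
  assumes "compact_group G T" "g \<in> carrier G"
  shows "continuous_map T T (\<lambda>x. g \<otimes>\<^bsub>G\<^esub> x)"
  using assms by (intro continuous_map_group_mult) (auto simp: compact_groupD(2))

lemma normalized_haar_borel_prob: "normalized_haar G T \<mu> \<Longrightarrow> borel_prob T \<mu>"
  unfolding normalized_haar_def borel_prob_def by auto

lemma normalized_haar_outer_regular: "normalized_haar G T \<mu> \<Longrightarrow> outer_regular T \<mu>"
  unfolding normalized_haar_def outer_regular_def by auto

lemma normalized_haar_integral:
  assumes G: "compact_group G T" and \<mu>: "normalized_haar G T \<mu>"
  shows "haar_integral G T \<mu>"
  unfolding haar_integral_def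
proof (intro conjI allI impI)
  show bp: "borel_prob T \<mu>" using \<mu> by (rule normalized_haar_borel_prob)
  interpret group G using G by (rule compact_groupD)
  fix f and g assume f: "continuous_map T euclideanreal f" and g: "g \<in> carrier G"
  have sp: "space \<mu> = carrier G" using borel_prob_space[OF bp] compact_groupD(2)[OF G] by simp
  have meas: "(\<lambda>x. h \<otimes>\<^bsub>G\<^esub> x) \<in> measurable \<mu> \<mu>" if "h \<in> carrier G" for h
    using bp by (intro continuous_map_measurable[OF continuous_map_left_translation[OF G that]])
      (auto simp: borel_prob_def)
  have "distr \<mu> \<mu> (\<lambda>x. g \<otimes>\<^bsub>G\<^esub> x) = \<mu>"
  proof (rule measure_eqI)
    fix A assume "A \<in> sets (distr \<mu> \<mu> (\<lambda>x. g \<otimes>\<^bsub>G\<^esub> x))"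
    then have A: "A \<in> sets \<mu>" by simp
    then have sub: "A \<subseteq> carrier G" using sets.sets_into_space sp by blast
    \<comment> \<open>\<open>normalized_haar\<close> states invariance for images, while
      \<open>distr\<close> uses preimages; translation by the inverse element converts one into the
      other.\<close>
    have "(\<lambda>x. g \<otimes>\<^bsub>G\<^esub> x) -` A \<inter> space \<mu> = (\<lambda>x. inv\<^bsub>G\<^esub> g \<otimes>\<^bsub>G\<^esub> x) ` A"
    proof (intro equalityI subsetI)
      fix x assume x: "x \<in> (\<lambda>x. g \<otimes>\<^bsub>G\<^esub> x) -` A \<inter> space \<mu>"
      then have "x = inv\<^bsub>G\<^esub> g \<otimes>\<^bsub>G\<^esub> (g \<otimes>\<^bsub>G\<^esub> x)"
        using g sp by (simp flip: m_assoc)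
      then show "x \<in> (\<lambda>x. inv\<^bsub>G\<^esub> g \<otimes>\<^bsub>G\<^esub> x) ` A" using x by blast
    next
      fix x assume "x \<in> (\<lambda>x. inv\<^bsub>G\<^esub> g \<otimes>\<^bsub>G\<^esub> x) ` A"
      then obtain a where "a \<in> A" "x = inv\<^bsub>G\<^esub> g \<otimes>\<^bsub>G\<^esub> a" by blast
      then show "x \<in> (\<lambda>x. g \<otimes>\<^bsub>G\<^esub> x) -` A \<inter> space \<mu>"
        using g sub sp by (auto simp flip: m_assoc)
    qed
    then show "emeasure (distr \<mu> \<mu> (\<lambda>x. g \<otimes>\<^bsub>G\<^esub> x)) A = emeasure \<mu> A"
      using \<mu> A g by (simp add: emeasure_distr[OF meas[OF g]] normalized_haar_def)
  qed simp
  then show "(\<integral>x. f (g \<otimes>\<^bsub>G\<^esub> x) \<partial>\<mu>) = (\<integral>x. f x \<partial>\<mu>)"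
    using integral_distr[OF meas[OF g] continuous_map_borel_measurable[OF f bp]] by simp
qed

text \<open>Integrate \<open>f (inv x \<otimes> y)\<close> over both variables. Doing
  \<open>y\<close> first gives the integral of \<open>f\<close> against \<open>\<nu>\<close> by left
  invariance; writing the argument as \<open>inv (inv y \<otimes> x)\<close> and doing
  \<open>x\<close> first gives the left-hand side. Allowing two measures yields uniqueness as well
  as invariance under inversion.\<close>

lemma haar_integral_inverse:
  assumes G: "compact_group G T" and \<mu>: "haar_integral G T \<mu>" and \<nu>: "haar_integral G T \<nu>"
    and f: "continuous_map T euclideanreal f"
  shows "(\<integral>x. f (inv\<^bsub>G\<^esub> x) \<partial>\<mu>) = (\<integral>x. f x \<partial>\<nu>)"
proof -
  interpret group G using G by (rule compact_groupD)
  have bp: "borel_prob T \<mu>" "borel_prob T \<nu>" using \<mu> \<nu> by (auto simp: haar_integral_def)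
  have sp: "space \<mu> = carrier G" "space \<nu> = carrier G"
    using borel_prob_space[OF bp(1)] borel_prob_space[OF bp(2)] compact_groupD(2)[OF G] by auto
  have fi: "continuous_map T euclideanreal (\<lambda>x. f (inv\<^bsub>G\<^esub> x))"
    using continuous_map_compose[OF compact_groupD(4)[OF G] f] by (simp add: o_def)
  have m: "continuous_map (prod_topology T T) T (\<lambda>p. inv\<^bsub>G\<^esub> fst p \<otimes>\<^bsub>G\<^esub> snd p)"
    by (intro continuous_map_group_mult[OF G] continuous_map_group_inv[OF G]
        continuous_map_fst continuous_map_snd)
  have "(\<integral>x. f x \<partial>\<nu>) = (\<integral>x. (\<integral>y. f (inv\<^bsub>G\<^esub> x \<otimes>\<^bsub>G\<^esub> y) \<partial>\<nu>) \<partial>\<mu>)"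
  proof -
    have "(\<integral>x. (\<integral>y. f (inv\<^bsub>G\<^esub> x \<otimes>\<^bsub>G\<^esub> y) \<partial>\<nu>) \<partial>\<mu>) = (\<integral>x. (\<integral>y. f y \<partial>\<nu>) \<partial>\<mu>)"
      by (rule Bochner_Integration.integral_cong[OF refl]) (auto simp: sp haar_integral_left[OF \<nu> f])
    then show ?thesis using integral_const_borel_prob[OF bp(1)] by simp
  qed
  also have "\<dots> = (\<integral>y. (\<integral>x. f (inv\<^bsub>G\<^esub> x \<otimes>\<^bsub>G\<^esub> y) \<partial>\<mu>) \<partial>\<nu>)"
    using continuous_map_compose[OF m f] compact_groupD(5)[OF G] bp
    by (intro Fubini_continuous_map[symmetric]) (auto simp: o_def case_prod_unfold)
  also have "\<dots> = (\<integral>y. (\<integral>x. f (inv\<^bsub>G\<^esub> (inv\<^bsub>G\<^esub> y \<otimes>\<^bsub>G\<^esub> x)) \<partial>\<mu>) \<partial>\<nu>)"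
    using sp by (intro Bochner_Integration.integral_cong) (auto simp: inv_mult_group)
  also have "\<dots> = (\<integral>y. (\<integral>x. f (inv\<^bsub>G\<^esub> x) \<partial>\<mu>) \<partial>\<nu>)"
    by (rule Bochner_Integration.integral_cong[OF refl]) (auto simp: sp haar_integral_left[OF \<mu> fi])
  finally show ?thesis using integral_const_borel_prob[OF bp(2)] by simp
qed

text \<open>Both integrals equal the integral of \<open>f (inv x)\<close> against
  \<open>\<mu>\<close>.\<close>

lemma haar_integral_unique:
  assumes "compact_group G T" "haar_integral G T \<mu>" "haar_integral G T \<nu>"
    "continuous_map T euclideanreal f"
  shows "(\<integral>x. f x \<partial>\<mu>) = (\<integral>x. f x \<partial>\<nu>)"
  using haar_integral_inverse[OF assms] haar_integral_inverse[OF assms(1,2,2,4)] by simp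

text \<open>Inversion turns right translation by \<open>g\<close> into left translation by
  \<open>inv g\<close>.\<close>

lemma haar_integral_right:
  assumes G: "compact_group G T" and \<mu>: "haar_integral G T \<mu>"
    and f: "continuous_map T euclideanreal f" and g: "g \<in> carrier G"
  shows "(\<integral>x. f (x \<otimes>\<^bsub>G\<^esub> g) \<partial>\<mu>) = (\<integral>x. f x \<partial>\<mu>)"
proof -
  interpret group G using G by (rule compact_groupD)
  have sp: "space \<mu> = carrier G"
    using \<mu> borel_prob_space compact_groupD(2)[OF G] by (metis haar_integral_def)
  have fi: "continuous_map T euclideanreal (\<lambda>x. f (inv\<^bsub>G\<^esub> x))"
    using continuous_map_compose[OF compact_groupD(4)[OF G] f] by (simp add: o_def)
  have "continuous_map T T (\<lambda>x. x \<otimes>\<^bsub>G\<^esub> g)"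
    using g compact_groupD(2)[OF G] by (intro continuous_map_group_mult[OF G]) auto
  then have "continuous_map T euclideanreal (\<lambda>x. f (x \<otimes>\<^bsub>G\<^esub> g))"
    using continuous_map_compose[OF _ f] by (simp add: o_def)
  from haar_integral_inverse[OF G \<mu> \<mu> this]
  have "(\<integral>x. f (x \<otimes>\<^bsub>G\<^esub> g) \<partial>\<mu>) = (\<integral>x. f (inv\<^bsub>G\<^esub> x \<otimes>\<^bsub>G\<^esub> g) \<partial>\<mu>)" by simp
  also have "\<dots> = (\<integral>x. f (inv\<^bsub>G\<^esub> (inv\<^bsub>G\<^esub> g \<otimes>\<^bsub>G\<^esub> x)) \<partial>\<mu>)"
    using g sp by (intro Bochner_Integration.integral_cong) (auto simp: inv_mult_group)
  also have "\<dots> = (\<integral>x. f (inv\<^bsub>G\<^esub> x) \<partial>\<mu>)"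
    using g by (simp add: haar_integral_left[OF \<mu> fi])
  also have "\<dots> = (\<integral>x. f x \<partial>\<mu>)" by (rule haar_integral_inverse[OF G \<mu> \<mu> f])
  finally show ?thesis .
qed

text \<open>The image of \<open>\<mu>\<close> under \<open>h\<close> is left invariant, because
  surjectivity lifts each translation of \<open>Q\<close> to one of \<open>P\<close>; uniqueness
  then identifies its integrals with those of \<open>\<nu>\<close>.\<close>

lemma haar_integral_hom_image:
  assumes P: "compact_group P S" "haar_integral P S \<mu>"
    and Q: "compact_group Q T" "haar_integral Q T \<nu>"
    and h: "h \<in> hom P Q" "h ` carrier P = carrier Q" "continuous_map S T h"
    and f: "continuous_map T euclideanreal f"
  shows "(\<integral>x. f (h x) \<partial>\<mu>) = (\<integral>x. f x \<partial>\<nu>)"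
proof -
  have bp: "borel_prob S \<mu>" using P(2) by (simp add: haar_integral_def)
  have sp: "space \<mu> = carrier P" using borel_prob_space[OF bp] compact_groupD(2)[OF P(1)] by simp
  have m: "h \<in> measurable \<mu> (borel_of T)"
    by (rule continuous_map_measurable[OF h(3) bp refl])
  have bpd: "borel_prob T (distr \<mu> (borel_of T) h)"
    unfolding borel_prob_def
  proof
    have "h -` topspace T \<inter> space \<mu> = space \<mu>"
      using h(3) borel_prob_space[OF bp] by (auto simp: continuous_map_def)
    then show "emeasure (distr \<mu> (borel_of T) h) (space (distr \<mu> (borel_of T) h)) = 1"
      using bp sets.top[of "borel_of T"] by (simp add: emeasure_distr[OF m] borel_prob_def)
  qed simp
  have int: "(\<integral>x. k x \<partial>distr \<mu> (borel_of T) h) = (\<integral>x. k (h x) \<partial>\<mu>)"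
    if "continuous_map T euclideanreal k" for k
  proof (rule integral_distr[OF m])
    have "k \<in> borel_measurable (distr \<mu> (borel_of T) h)"
      by (rule continuous_map_borel_measurable[OF that bpd])
    then show "k \<in> borel_measurable (borel_of T)" by simp
  qed
  have "haar_integral Q T (distr \<mu> (borel_of T) h)"
    unfolding haar_integral_def
  proof (intro conjI allI impI)
    fix k and q assume k: "continuous_map T euclideanreal k" and q: "q \<in> carrier Q"
    from q h(2) obtain p where p: "p \<in> carrier P" "q = h p" by blast
    have kq: "continuous_map T euclideanreal (\<lambda>x. k (q \<otimes>\<^bsub>Q\<^esub> x))"
      using continuous_map_compose[OF continuous_map_left_translation[OF Q(1) q] k]
      by (simp add: o_def)
    have kh: "continuous_map S euclideanreal (\<lambda>x. k (h x))"
      using continuous_map_compose[OF h(3) k] by (simp add: o_def)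
    have "(\<integral>x. k (q \<otimes>\<^bsub>Q\<^esub> h x) \<partial>\<mu>) = (\<integral>x. k (h (p \<otimes>\<^bsub>P\<^esub> x)) \<partial>\<mu>)"
      using p sp hom_mult[OF h(1)] by (intro Bochner_Integration.integral_cong) auto
    then show "(\<integral>x. k (q \<otimes>\<^bsub>Q\<^esub> x) \<partial>distr \<mu> (borel_of T) h) = (\<integral>x. k x \<partial>distr \<mu> (borel_of T) h)"
      using haar_integral_left[OF P(2) kh p(1)] by (simp add: int[OF kq] int[OF k])
  qed (rule bpd)
  then show ?thesis using haar_integral_unique[OF Q(1) _ Q(2) f] int[OF f] by simp
qed

text \<open>Right translation by \<open>e k\<close> preserves Haar integrals for each
  \<open>k\<close>, so \<open>E\<close> can be measured through its fibres
  \<open>{k. x \<otimes> e k \<in> E}\<close>. The hypothesis \<open>slice\<close> moves such a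
  fibre by a left translation into the corresponding fibre of \<open>E'\<close>, and left
  translation preserves the measure. With \<open>e\<close> projecting onto one factor of a product,
  this compares sets in one variable at a time.\<close>

lemma haar_measure_le_of_slices:
  assumes P: "compact_group P T" and \<mu>: "normalized_haar P T \<mu>"
    and e: "continuous_map T T e" and E: "closedin T E" "closedin T E'"
    and slice: "\<And>x. x \<in> carrier P \<Longrightarrow>
      \<exists>t\<in>carrier P. \<forall>k\<in>carrier P. x \<otimes>\<^bsub>P\<^esub> e k \<in> E \<longrightarrow> x \<otimes>\<^bsub>P\<^esub> e (t \<otimes>\<^bsub>P\<^esub> k) \<in> E'"
  shows "measure \<mu> E \<le> measure \<mu> E'"
proof (rule field_le_epsilon)
  fix \<epsilon> :: real assume \<epsilon>: "\<epsilon> > 0"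
  note bp = normalized_haar_borel_prob[OF \<mu>] and hi = normalized_haar_integral[OF P \<mu>]
  note top = compact_groupD[OF P]
  have E': "E' \<in> sets \<mu>" using borel_prob_closedin[OF bp E(2)] .
  \<comment> \<open>\<open>measure_le_integral_average\<close> needs a continuous bound, so
    \<open>E'\<close> is replaced by a function \<open>f\<close> lying between its indicator and
    that of \<open>U\<close>.\<close>
  obtain U where U: "openin T U" "E' \<subseteq> U" "measure \<mu> U < measure \<mu> E' + \<epsilon>"
    using outer_regularE[OF normalized_haar_outer_regular[OF \<mu>] bp E' \<epsilon>] by blast
  have dj: "closedin T (topspace T - U)" "disjnt E' (topspace T - U)"
    using U by (auto simp: disjnt_iff)
  obtain f where f: "continuous_map T euclideanreal f"
    "\<forall>x\<in>topspace T. 0 \<le> f x" "\<forall>x\<in>topspace T. f x \<le> 1"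
    "\<forall>x\<in>E'. f x = 1" "\<forall>x\<in>topspace T - U. f x = 0"
    using Urysohn_compact_Hausdorff[OF top(5,6) E(2) dj] by blast
  let ?\<theta> = "\<lambda>x k. x \<otimes>\<^bsub>P\<^esub> e k"
  have ecar: "e k \<in> carrier P" if "k \<in> carrier P" for k
    using e that top(2) by (auto simp: continuous_map_def Pi_iff)
  have "continuous_map (prod_topology T T) T (\<lambda>p. fst p \<otimes>\<^bsub>P\<^esub> e (snd p))"
    using continuous_map_compose[OF continuous_map_snd e]
    by (intro continuous_map_group_mult[OF P] continuous_map_fst) (simp add: o_def)
  then have \<theta>: "continuous_map (prod_topology T T) T (\<lambda>(x, k). ?\<theta> x k)"
    by (simp add: case_prod_unfold)
  have inv: "(\<integral>x. h (?\<theta> x k) \<partial>\<mu>) = (\<integral>x. h x \<partial>\<mu>)"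
    if "continuous_map T euclideanreal h" "k \<in> topspace T" for h k
    using haar_integral_right[OF P hi that(1) ecar] that(2) top(2) by simp
  have fslice: "continuous_map T euclideanreal (\<lambda>k. f (?\<theta> x k))" if "x \<in> carrier P" for x
    using that top(2) e continuous_map_compose[OF continuous_map_group_mult[OF P _ e, of "\<lambda>k. x"] f(1)]
    by (simp add: o_def)
  have "measure \<mu> E \<le> (\<integral>x. (\<integral>k. f (?\<theta> x k) \<partial>\<mu>) \<partial>\<mu>)"
  proof (rule measure_le_integral_average[OF top(5,6) bp top(5) bp normalized_haar_outer_regular[OF \<mu>]
        \<theta> inv E(1)])
    show "continuous_map T euclideanreal (\<lambda>x. \<integral>k. f (?\<theta> x k) \<partial>\<mu>)"
      using continuous_map_compose[OF \<theta> f(1)]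
      by (intro continuous_map_integral[OF top(5) bp]) (simp add: o_def case_prod_unfold)
    fix x assume "x \<in> topspace T"
    then have x: "x \<in> carrier P" using top(2) by simp
    from slice[OF x] obtain t where t: "t \<in> carrier P"
      "\<And>k. k \<in> carrier P \<Longrightarrow> ?\<theta> x k \<in> E \<Longrightarrow> ?\<theta> x (t \<otimes>\<^bsub>P\<^esub> k) \<in> E'" by blast
    have tk: "t \<otimes>\<^bsub>P\<^esub> k \<in> carrier P" if "k \<in> carrier P" for k
      using t(1) that top(1) by (simp add: group.is_monoid monoid.m_closed)
    have xe: "continuous_map T T (\<lambda>k. ?\<theta> x k)"
      using x top(2) by (intro continuous_map_group_mult[OF P _ e]) auto
    have "continuous_map T euclideanreal (\<lambda>k. f (?\<theta> x (t \<otimes>\<^bsub>P\<^esub> k)))"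
      using continuous_map_compose[OF continuous_map_left_translation[OF P t(1)] fslice[OF x]]
      by (simp add: o_def)
    then have "measure \<mu> {k \<in> topspace T. ?\<theta> x k \<in> E} \<le> (\<integral>k. f (?\<theta> x (t \<otimes>\<^bsub>P\<^esub> k)) \<partial>\<mu>)"
    proof (rule measure_le_integral[OF top(5) bp])
      show "{k \<in> topspace T. ?\<theta> x k \<in> E} \<in> sets \<mu>"
        by (intro borel_prob_closedin[OF bp] closedin_continuous_map_preimage[OF xe] E)
      show "0 \<le> f (?\<theta> x (t \<otimes>\<^bsub>P\<^esub> k))" if "k \<in> topspace T" for k
        using that tk xe f(2) top(2) by (auto simp: continuous_map_def Pi_iff)
      show "1 \<le> f (?\<theta> x (t \<otimes>\<^bsub>P\<^esub> k))" if "k \<in> {k \<in> topspace T. ?\<theta> x k \<in> E}" for k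
        using that t(2) f(4) top(2) by auto
    qed
    \<comment> \<open>The witness \<open>t\<close> varies with \<open>x\<close> in no controlled
      way; left invariance in \<open>k\<close> eliminates it and leaves a bound that is continuous
      in \<open>x\<close>.\<close>
    also have "\<dots> = (\<integral>k. f (?\<theta> x k) \<partial>\<mu>)" by (rule haar_integral_left[OF hi fslice[OF x] t(1)])
    finally show "measure \<mu> {k \<in> topspace T. ?\<theta> x k \<in> E} \<le> (\<integral>k. f (?\<theta> x k) \<partial>\<mu>)" .
  qed
  also have "\<dots> = (\<integral>x. f x \<partial>\<mu>)"
    using integral_average[OF top(5) bp top(5) bp \<theta> inv f(1)] f(1) by simp
  also have "\<dots> \<le> measure \<mu> U"
    using f borel_prob_openin[OF bp U(1)] by (intro integral_le_measure[OF top(5) bp]) auto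
  finally show "measure \<mu> E \<le> measure \<mu> E' + \<epsilon>" using U(3) by simp
qed

section \<open>Subgroups, products and quotients of compact groups\<close>

lemma compact_group_subgroup:
  assumes G: "compact_group G T" and H: "subgroup H G" "closedin T H"
  shows "compact_group (G\<lparr>carrier := H\<rparr>) (subtopology T H)"
proof -
  note top = compact_groupD[OF G]
  interpret group G by (rule top(1))
  have sub: "H \<subseteq> carrier G" using H(1) by (rule subgroup.subset)
  have incl: "continuous_map (subtopology T H) T id"
    by (simp add: continuous_map_from_subtopology)
  have m: "continuous_map (prod_topology (subtopology T H) (subtopology T H)) T
      (\<lambda>p. fst p \<otimes>\<^bsub>G\<^esub> snd p)"
    using continuous_map_compose[OF continuous_map_fst incl] continuous_map_compose[OF continuous_map_snd incl]
    by (intro continuous_map_group_mult[OF G]) (simp_all add: o_def)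
  have "continuous_map (subtopology T H) (subtopology T H) (\<lambda>x. inv\<^bsub>G\<^esub> x)"
    using top(4) H(1) by (auto simp: continuous_map_in_subtopology continuous_map_from_subtopology
        subgroup.m_inv_closed)
  then have "continuous_map (subtopology T H) (subtopology T H) (\<lambda>x. inv\<^bsub>G\<lparr>carrier := H\<rparr>\<^esub> x)"
    by (rule continuous_map_eq) (simp add: m_inv_consistent[OF H(1)])
  moreover have "continuous_map (prod_topology (subtopology T H) (subtopology T H)) (subtopology T H)
      (\<lambda>(x, y). x \<otimes>\<^bsub>G\<^esub> y)"
    using m H(1) by (auto simp: continuous_map_in_subtopology case_prod_unfold subgroup.m_closed)
  ultimately show ?thesis
    using top sub H unfolding compact_group_def
    by (auto simp: subgroup_imp_group compact_space_subtopology closedin_compact_space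
        Hausdorff_space_subtopology)
qed

lemma compact_group_DirProd:
  assumes A: "compact_group A S" and B: "compact_group B T"
  shows "compact_group (A \<times>\<times> B) (prod_topology S T)"
proof -
  let ?P = "prod_topology S T"
  note a = compact_groupD[OF A] and b = compact_groupD[OF B]
  have "continuous_map (prod_topology ?P ?P) S (\<lambda>p. fst (fst p) \<otimes>\<^bsub>A\<^esub> fst (snd p))"
    by (intro continuous_map_group_mult[OF A])
      (auto intro: continuous_map_fst continuous_map_snd
        continuous_map_compose[of _ ?P _ _ fst, unfolded o_def])
  moreover have "continuous_map (prod_topology ?P ?P) T (\<lambda>p. snd (fst p) \<otimes>\<^bsub>B\<^esub> snd (snd p))"
    by (intro continuous_map_group_mult[OF B])
      (auto intro: continuous_map_fst continuous_map_snd
        continuous_map_compose[of _ ?P _ _ snd, unfolded o_def])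
  ultimately have "continuous_map (prod_topology ?P ?P) ?P (\<lambda>(p, q). p \<otimes>\<^bsub>A \<times>\<times> B\<^esub> q)"
    by (simp add: DirProd_def case_prod_unfold continuous_map_pairedI)
  moreover have "continuous_map ?P ?P (\<lambda>p. (inv\<^bsub>A\<^esub> fst p, inv\<^bsub>B\<^esub> snd p))"
    by (intro continuous_map_pairedI continuous_map_group_inv[OF A] continuous_map_group_inv[OF B]
        continuous_map_fst continuous_map_snd)
  then have "continuous_map ?P ?P (\<lambda>p. inv\<^bsub>A \<times>\<times> B\<^esub> p)"
    by (rule continuous_map_eq) (use a b in \<open>auto simp: inv_DirProd\<close>)
  ultimately show ?thesis
    using a b unfolding compact_group_def
    by (auto simp: DirProd_group compact_space_prod_topology Hausdorff_space_prod_topology)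
qed

section \<open>The quotient topology and factor groups\<close>

lemma openin_quot_topology:
  "openin (quot_topology S f) V \<longleftrightarrow> V \<subseteq> f ` topspace S \<and> openin S {x. x \<in> topspace S \<and> f x \<in> V}"
proof -
  have "istopology (\<lambda>V. V \<subseteq> f ` topspace S \<and> openin S {x. x \<in> topspace S \<and> f x \<in> V})"
    unfolding istopology_def
  proof (intro conjI allI impI)
    fix U V assume *: "U \<subseteq> f ` topspace S \<and> openin S {x. x \<in> topspace S \<and> f x \<in> U}"
      "V \<subseteq> f ` topspace S \<and> openin S {x. x \<in> topspace S \<and> f x \<in> V}"
    then show "U \<inter> V \<subseteq> f ` topspace S" by blast
    have "{x. x \<in> topspace S \<and> f x \<in> U \<inter> V}
        = {x. x \<in> topspace S \<and> f x \<in> U} \<inter> {x. x \<in> topspace S \<and> f x \<in> V}" by blast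
    also have "openin S \<dots>" using * by (intro openin_Int) auto
    finally show "openin S {x. x \<in> topspace S \<and> f x \<in> U \<inter> V}" .
  next
    fix \<K> assume *: "\<forall>K\<in>\<K>. K \<subseteq> f ` topspace S \<and> openin S {x. x \<in> topspace S \<and> f x \<in> K}"
    then show "\<Union>\<K> \<subseteq> f ` topspace S" by blast
    have "{x. x \<in> topspace S \<and> f x \<in> \<Union>\<K>} = (\<Union>K\<in>\<K>. {x. x \<in> topspace S \<and> f x \<in> K})" by blast
    then show "openin S {x. x \<in> topspace S \<and> f x \<in> \<Union>\<K>}" using * by auto
  qed
  then show ?thesis unfolding quot_topology_def by (simp add: topology_inverse')
qed

lemma topspace_quot_topology: "topspace (quot_topology S f) = f ` topspace S"
proof
  show "topspace (quot_topology S f) \<subseteq> f ` topspace S"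
    using openin_topspace openin_quot_topology by metis
  have "openin (quot_topology S f) (f ` topspace S)"
  proof -
    have "{x. x \<in> topspace S \<and> f x \<in> f ` topspace S} = topspace S" by blast
    then show ?thesis by (simp add: openin_quot_topology)
  qed
  then show "f ` topspace S \<subseteq> topspace (quot_topology S f)" by (rule openin_subset)
qed

lemma continuous_map_quot_topology: "continuous_map S (quot_topology S f) f"
  by (auto simp: continuous_map_def topspace_quot_topology openin_quot_topology)

text \<open>An open rectangle around \<open>(x, y)\<close> avoiding the closed relation has sides
  with disjoint images, and these images are open because \<open>f\<close> is an open map.\<close>

lemma Hausdorff_space_open_map_image:
  assumes f: "open_map S Y f" "f ` topspace S = topspace Y"
    and R: "closedin (prod_topology S S) {p \<in> topspace S \<times> topspace S. f (fst p) = f (snd p)}"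
  shows "Hausdorff_space Y"
  unfolding Hausdorff_space_def
proof (intro allI impI)
  fix u v assume uv: "u \<in> topspace Y \<and> v \<in> topspace Y \<and> u \<noteq> v"
  then obtain x y where xy: "x \<in> topspace S" "u = f x" "y \<in> topspace S" "v = f y"
    using f(2) by (metis imageE)
  let ?W = "topspace (prod_topology S S) - {p \<in> topspace S \<times> topspace S. f (fst p) = f (snd p)}"
  have "openin (prod_topology S S) ?W" using R by blast
  moreover have "(x, y) \<in> ?W" using xy uv by auto
  ultimately obtain U V where UV: "openin S U" "openin S V" "x \<in> U" "y \<in> V" "U \<times> V \<subseteq> ?W"
    unfolding openin_prod_topology_alt by meson
  have "disjnt (f ` U) (f ` V)"
  proof -
    have "f a \<noteq> f b" if "a \<in> U" "b \<in> V" for a b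
      using UV(5) that by auto
    then show ?thesis by (auto simp: disjnt_iff)
  qed
  then show "\<exists>U V. openin Y U \<and> openin Y V \<and> u \<in> U \<and> v \<in> V \<and> disjnt U V"
    using UV xy f(1) unfolding open_map_def by blast
qed

lemma (in normal) r_coset_eq_iff:
  assumes "x \<in> carrier G" "y \<in> carrier G"
  shows "H #> x = H #> y \<longleftrightarrow> x \<otimes> inv y \<in> H"
proof -
  have "H #> x = H #> y \<longleftrightarrow> x \<in> H #> y"
    using assms repr_independence[OF _ _ subgroup_axioms] rcos_self[OF _ subgroup_axioms] by metis
  then show ?thesis using rcos_module[OF is_group assms(2,1)] by simp
qed

text \<open>Once the projection is known to be open, closedness of \<open>N\<close> gives the
  Hausdorff property, and the group operations descend along quotient maps.\<close>

lemma compact_group_FactGroup: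
  fixes G (structure)
  assumes G: "compact_group G T" and N: "normal N G" "closedin T N"
  shows "compact_group (G Mod N) (quot_topology T (\<lambda>x. N #> x))"
proof -
  note top = compact_groupD[OF G]
  interpret group G by (rule top(1))
  interpret N: normal N G by (rule N(1))
  let ?p = "\<lambda>x. N #> x"
  let ?Q = "quot_topology T ?p"
  have cont: "continuous_map T ?Q ?p" by (rule continuous_map_quot_topology)
  have tQ: "topspace ?Q = carrier (G Mod N)"
    by (simp add: topspace_quot_topology carrier_FactGroup top(2))
  have op: "open_map T ?Q ?p"
    unfolding open_map_def
  proof (intro allI impI)
    fix U assume U: "openin T U"
    then have sub: "U \<subseteq> carrier G" using openin_subset top(2) by metis
    \<comment> \<open>The saturation of an open set is the union of its preimages under left
      translations by elements of \<open>N\<close>, hence open.\<close>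
    have "{x. x \<in> topspace T \<and> ?p x \<in> ?p ` U} = (\<Union>n\<in>N. {x \<in> topspace T. n \<otimes> x \<in> U})"
    proof (intro equalityI subsetI)
      fix x assume "x \<in> {x. x \<in> topspace T \<and> ?p x \<in> ?p ` U}"
      then obtain u where u: "x \<in> carrier G" "u \<in> U" "?p u = ?p x" using top(2) by auto
      then have "u \<otimes> inv x \<in> N" "(u \<otimes> inv x) \<otimes> x \<in> U"
        using sub N.r_coset_eq_iff[of u x] by (auto simp: m_assoc subset_iff)
      then show "x \<in> (\<Union>n\<in>N. {x \<in> topspace T. n \<otimes> x \<in> U})" using u(1) top(2) by blast
    next
      fix x assume "x \<in> (\<Union>n\<in>N. {x \<in> topspace T. n \<otimes> x \<in> U})"
      then obtain n where n: "n \<in> N" "x \<in> carrier G" "n \<otimes> x \<in> U" using top(2) by auto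
      then have "?p (n \<otimes> x) = ?p x"
        using sub N.r_coset_eq_iff[of "n \<otimes> x" x] by (auto simp: m_assoc subset_iff)
      then show "x \<in> {x. x \<in> topspace T \<and> ?p x \<in> ?p ` U}" using n top(2) by (auto simp: image_iff)
    qed
    moreover have "openin T {x \<in> topspace T. n \<otimes> x \<in> U}" if "n \<in> N" for n
      using that by (intro openin_continuous_map_preimage[OF continuous_map_left_translation[OF G] U]) auto
    ultimately show "openin ?Q (?p ` U)"
      using sub top(2) by (auto simp: openin_quot_topology)
  qed
  have haus: "Hausdorff_space ?Q"
  proof (rule Hausdorff_space_open_map_image[OF op])
    \<comment> \<open>The relation of having equal cosets is the preimage of the closed set
      \<open>N\<close> under this map.\<close>
    have "continuous_map (prod_topology T T) T (\<lambda>p. fst p \<otimes> inv (snd p))"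
      by (intro continuous_map_group_mult[OF G] continuous_map_group_inv[OF G] continuous_map_fst
          continuous_map_snd)
    from closedin_continuous_map_preimage[OF this N(2)]
    have "closedin (prod_topology T T)
        {p \<in> topspace (prod_topology T T). fst p \<otimes> inv (snd p) \<in> N}" .
    also have "{p \<in> topspace (prod_topology T T). fst p \<otimes> inv (snd p) \<in> N}
        = {p \<in> topspace T \<times> topspace T. ?p (fst p) = ?p (snd p)}"
      using top(2) by (intro Collect_cong conj_cong) (simp_all add: mem_Times_iff N.r_coset_eq_iff)
    finally show "closedin (prod_topology T T) {p \<in> topspace T \<times> topspace T. ?p (fst p) = ?p (snd p)}" .
  qed (simp add: topspace_quot_topology)
  have comp: "compact_space ?Q"
    using top(5) image_compactin[OF _ cont, of "topspace T"]
    by (simp add: compact_space_def topspace_quot_topology)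
  have qp: "quotient_map T ?Q ?p"
    by (rule continuous_open_imp_quotient_map[OF cont op]) (simp add: topspace_quot_topology)
  let ?p2 = "\<lambda>p. (?p (fst p), ?p (snd p))"
  have c2: "continuous_map (prod_topology T T) (prod_topology ?Q ?Q) ?p2"
    using continuous_map_compose[OF continuous_map_fst cont] continuous_map_compose[OF continuous_map_snd cont]
    by (intro continuous_map_pairedI) (simp_all add: o_def)
  \<comment> \<open>Products of quotient maps need not be quotient maps; here the map is closed,
    going from a compact space to a Hausdorff one.\<close>
  have qp2: "quotient_map (prod_topology T T) (prod_topology ?Q ?Q) ?p2"
  proof (rule continuous_closed_imp_quotient_map[OF c2])
    show "closed_map (prod_topology T T) (prod_topology ?Q ?Q) ?p2"
      using c2 top(5) haus by (intro continuous_imp_closed_map)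
        (auto simp: compact_space_prod_topology Hausdorff_space_prod_topology)
    show "?p2 ` topspace (prod_topology T T) = topspace (prod_topology ?Q ?Q)"
      by (force simp: topspace_quot_topology)
  qed
  have "continuous_map (prod_topology T T) ?Q (\<lambda>p. ?p (fst p \<otimes> snd p))"
    using continuous_map_compose[OF top(3) cont] by (simp add: o_def case_prod_unfold)
  then have "continuous_map (prod_topology T T) ?Q ((\<lambda>(x, y). x \<otimes>\<^bsub>G Mod N\<^esub> y) \<circ> ?p2)"
    by (rule continuous_map_eq) (auto simp: N.rcos_sum top(2))
  then have "continuous_map (prod_topology ?Q ?Q) ?Q (\<lambda>(x, y). x \<otimes>\<^bsub>G Mod N\<^esub> y)"
    by (rule continuous_compose_quotient_map[OF qp2])
  moreover have "continuous_map ?Q ?Q (\<lambda>x. inv\<^bsub>G Mod N\<^esub> x)"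
  proof (rule continuous_compose_quotient_map[OF qp])
    have "continuous_map T ?Q (\<lambda>x. ?p (inv x))"
      using continuous_map_compose[OF top(4) cont] by (simp add: o_def)
    then show "continuous_map T ?Q ((\<lambda>x. inv\<^bsub>G Mod N\<^esub> x) \<circ> ?p)"
      by (rule continuous_map_eq)
        (auto simp: top(2) N.inv_FactGroup N.rcos_inv carrier_FactGroup)
  qed
  ultimately show ?thesis
    using N.factorgroup_is_group tQ comp haus unfolding compact_group_def by auto
qed

section \<open>Commuting pairs\<close>

lemma (in group) commutator_eq_one_iff:
  assumes "x \<in> carrier G" "y \<in> carrier G"
  shows "commutator G x y = \<one> \<longleftrightarrow> x \<otimes> y = y \<otimes> x"
proof -
  have "commutator G x y = inv (y \<otimes> x) \<otimes> (x \<otimes> y)"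
    using assms by (simp add: commutator_def inv_mult_group m_assoc)
  also have "\<dots> = \<one> \<longleftrightarrow> x \<otimes> y = y \<otimes> x"
    using assms by (metis inv_equality inv_inv inv_closed m_closed l_inv r_inv l_cancel_one)
  finally show ?thesis .
qed

text \<open>Centralizers are subgroups. For \<open>x = h n\<close> and \<open>x' = h n'\<close> the
  product \<open>inv x \<otimes> x'\<close> is free of \<open>h\<close>, which is how translating
  factors are cancelled below.\<close>

lemma (in group) commute_inv_mult:
  assumes "x \<in> carrier G" "x' \<in> carrier G" "y \<in> carrier G"
    and "x \<otimes> y = y \<otimes> x" "x' \<otimes> y = y \<otimes> x'"
  shows "(inv x \<otimes> x') \<otimes> y = y \<otimes> (inv x \<otimes> x')"
proof -
  have "inv x \<otimes> y = y \<otimes> inv x"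
  proof -
    have "inv x \<otimes> y = inv x \<otimes> (y \<otimes> x) \<otimes> inv x"
      using assms(1-3) by (simp add: m_assoc)
    also have "\<dots> = inv x \<otimes> (x \<otimes> y) \<otimes> inv x" using assms(4) by simp
    also have "\<dots> = y \<otimes> inv x" using assms(1-3) by (simp flip: m_assoc)
    finally show ?thesis .
  qed
  then show ?thesis using assms by (metis inv_closed m_assoc)
qed

text \<open>The set is a preimage of the identity, a closed point in a Hausdorff group. Keeping
  \<open>a\<close> and \<open>b\<close> general covers pairs in a product, translated pairs and
  pairs of cosets at once.\<close>

lemma closedin_commuting:
  assumes G: "compact_group G T" and ab: "continuous_map S T a" "continuous_map S T b"
  shows "closedin S {x \<in> topspace S. commutator G (a x) (b x) = \<one>\<^bsub>G\<^esub>}"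
proof -
  note top = compact_groupD[OF G]
  have "continuous_map S T (\<lambda>x. commutator G (a x) (b x))"
    unfolding commutator_def
    by (intro continuous_map_group_mult[OF G] continuous_map_group_inv[OF G] ab)
  moreover have "closedin T {\<one>\<^bsub>G\<^esub>}"
    using top by (simp add: closedin_Hausdorff_singleton group.is_monoid monoid.one_closed)
  ultimately have "closedin S {x \<in> topspace S. commutator G (a x) (b x) \<in> {\<one>\<^bsub>G\<^esub>}}"
    by (rule closedin_continuous_map_preimage)
  then show ?thesis by simp
qed

lemma (in normal) commutator_FactGroup:
  assumes "x \<in> carrier G" "y \<in> carrier G"
  shows "commutator (G Mod H) (H #> x) (H #> y) = H #> commutator G x y"
  using assms unfolding commutator_def
  by (simp add: inv_FactGroup rcos_inv carrier_FactGroup rcos_sum)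

lemma (in normal) commutator_FactGroup_eq_one_iff:
  assumes "x \<in> carrier G" "y \<in> carrier G"
  shows "commutator (G Mod H) (H #> x) (H #> y) = \<one>\<^bsub>G Mod H\<^esub> \<longleftrightarrow> commutator G x y \<in> H"
proof -
  have c: "commutator G x y \<in> carrier G" using assms by (simp add: commutator_def)
  have "H #> commutator G x y = H \<longleftrightarrow> commutator G x y \<in> H"
    using c coset_join1[OF _ c subgroup_axioms] coset_join2[OF c subgroup_axioms] by blast
  then show ?thesis using assms by (simp add: commutator_FactGroup)
qed

text \<open>For fixed \<open>m\<close>, the \<open>n\<close> for which \<open>h n\<close> commutes with \<open>g m\<close> are none or a left coset of the
  centralizer of \<open>g m\<close> in \<open>N\<close>, which makes \<open>h\<close> removable; likewise for \<open>g\<close> with \<open>n\<close> fixed.\<close>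

lemma measure_commuting_translates_le:
  fixes G (structure)
  assumes G: "compact_group G T" and N: "subgroup N G" "closedin T N"
    and \<mu>: "normalized_haar (G\<lparr>carrier := N\<rparr> \<times>\<times> G\<lparr>carrier := N\<rparr>)
              (prod_topology (subtopology T N) (subtopology T N)) \<mu>"
    and hg: "h \<in> carrier G" "g \<in> carrier G"
  shows "measure \<mu> {p \<in> N \<times> N. commutator G (h \<otimes> fst p) (g \<otimes> snd p) = \<one>}
         \<le> measure \<mu> {p \<in> N \<times> N. commutator G (fst p) (snd p) = \<one>}"
proof -
  note top = compact_groupD[OF G]
  interpret group G by (rule top(1))
  interpret N: subgroup N G by (rule N(1))
  let ?P = "G\<lparr>carrier := N\<rparr> \<times>\<times> G\<lparr>carrier := N\<rparr>"
  let ?T = "prod_topology (subtopology T N) (subtopology T N)"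
  have P: "compact_group ?P ?T"
    by (intro compact_group_DirProd compact_group_subgroup G N)
  have tP: "topspace ?T = N \<times> N" using compact_groupD(2)[OF P] by simp
  have c: "continuous_map ?T (subtopology T N) fst" "continuous_map ?T (subtopology T N) snd"
    by (auto intro: continuous_map_fst continuous_map_snd)
  then have cT: "continuous_map ?T T fst" "continuous_map ?T T snd"
    by (auto dest: continuous_map_into_fulltopology)
  have one: "continuous_map ?T (subtopology T N) (\<lambda>p. \<one>)"
    using N.subset top(2) by auto
  have cancel: "inv u \<otimes> (u \<otimes> v) = v" if "u \<in> carrier G" "v \<in> carrier G" for u v
    using that by (simp flip: m_assoc)
  \<comment> \<open>Two parameters allow the translations to be removed one after the other, from
    \<open>E h g\<close> via \<open>E \<one> g\<close> to \<open>E \<one> \<one>\<close>.\<close>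
  define E where "E u v = {p \<in> N \<times> N. commutator G (u \<otimes> fst p) (v \<otimes> snd p) = \<one>}" for u v
  have E: "closedin ?T (E u v)" if "u \<in> carrier G" "v \<in> carrier G" for u v
  proof -
    have "closedin ?T {p \<in> topspace ?T. commutator G (u \<otimes> fst p) (v \<otimes> snd p) = \<one>}"
      using that cT top(2) by (intro closedin_commuting[OF G] continuous_map_group_mult[OF G]) auto
    then show ?thesis by (simp only: tP E_def)
  qed
  have E_iff: "(n, m) \<in> E u v \<longleftrightarrow> (u \<otimes> n) \<otimes> (v \<otimes> m) = (v \<otimes> m) \<otimes> (u \<otimes> n)"
    if "n \<in> N" "m \<in> N" "u \<in> carrier G" "v \<in> carrier G" for n m u v
    using that by (simp add: E_def commutator_eq_one_iff)
  have "measure \<mu> (E h g) \<le> measure \<mu> (E \<one> g)"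
  proof (rule haar_measure_le_of_slices[OF P \<mu>])
    \<comment> \<open>Multiplying by \<open>(fst p, \<one>)\<close> moves the first coordinate only,
      so the second entry \<open>g \<otimes> b\<close> is fixed along a slice.\<close>
    show "continuous_map ?T ?T (\<lambda>p. (fst p, \<one>))" by (intro continuous_map_pairedI c one)
    fix x assume "x \<in> carrier ?P"
    then obtain a b where x: "x = (a, b)" "a \<in> N" "b \<in> N" by auto
    show "\<exists>t\<in>carrier ?P. \<forall>k\<in>carrier ?P. x \<otimes>\<^bsub>?P\<^esub> (fst k, \<one>) \<in> E h g
        \<longrightarrow> x \<otimes>\<^bsub>?P\<^esub> (fst (t \<otimes>\<^bsub>?P\<^esub> k), \<one>) \<in> E \<one> g"
    \<comment> \<open>With a reference point \<open>n0\<close> of the slice, \<open>t\<close> sends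
      \<open>a \<otimes> n\<close> to \<open>inv n0 \<otimes> n\<close>, the quotient of two
      elements commuting with \<open>g \<otimes> b\<close>, in which \<open>h\<close> and
      \<open>a\<close> cancel. An empty slice admits any \<open>t\<close>.\<close>
    proof (cases "\<exists>n0\<in>N. (a \<otimes> n0, b) \<in> E h g")
      case True
      then obtain n0 where n0: "n0 \<in> N" "(a \<otimes> n0, b) \<in> E h g" by blast
      have "(a \<otimes> (inv a \<otimes> inv n0 \<otimes> n), b) \<in> E \<one> g" if n: "n \<in> N" "(a \<otimes> n, b) \<in> E h g" for n
      proof -
        have "inv (h \<otimes> (a \<otimes> n0)) \<otimes> (h \<otimes> (a \<otimes> n)) = inv n0 \<otimes> n"
          using x n(1) n0(1) hg by (simp add: inv_mult_group m_assoc cancel)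
        moreover have "a \<otimes> (inv a \<otimes> inv n0 \<otimes> n) = inv n0 \<otimes> n"
          using x n(1) n0(1) by (simp flip: m_assoc)
        ultimately show ?thesis
          using commute_inv_mult[of "h \<otimes> (a \<otimes> n0)" "h \<otimes> (a \<otimes> n)" "g \<otimes> b"] x n n0 hg
          by (simp add: E_iff)
      qed
      then show ?thesis
        using x n0(1) by (intro bexI[of _ "(inv a \<otimes> inv n0, \<one>)"]) auto
    next
      case False
      then show ?thesis using x by (intro bexI[of _ "(\<one>, \<one>)"]) auto
    qed
  qed (use E hg in auto)
  also have "\<dots> \<le> measure \<mu> (E \<one> \<one>)"
  proof (rule haar_measure_le_of_slices[OF P \<mu>])
    \<comment> \<open>The same argument with the coordinates exchanged: the elements
      \<open>g \<otimes> (b \<otimes> m)\<close> now commute with the fixed \<open>a\<close>, from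
      which the translation by \<open>h\<close> has already been removed.\<close>
    show "continuous_map ?T ?T (\<lambda>p. (\<one>, snd p))" by (intro continuous_map_pairedI c one)
    fix x assume "x \<in> carrier ?P"
    then obtain a b where x: "x = (a, b)" "a \<in> N" "b \<in> N" by auto
    show "\<exists>t\<in>carrier ?P. \<forall>k\<in>carrier ?P. x \<otimes>\<^bsub>?P\<^esub> (\<one>, snd k) \<in> E \<one> g
        \<longrightarrow> x \<otimes>\<^bsub>?P\<^esub> (\<one>, snd (t \<otimes>\<^bsub>?P\<^esub> k)) \<in> E \<one> \<one>"
    proof (cases "\<exists>m0\<in>N. (a, b \<otimes> m0) \<in> E \<one> g")
      case True
      then obtain m0 where m0: "m0 \<in> N" "(a, b \<otimes> m0) \<in> E \<one> g" by blast
      have "(a, b \<otimes> (inv b \<otimes> inv m0 \<otimes> m)) \<in> E \<one> \<one>" if m: "m \<in> N" "(a, b \<otimes> m) \<in> E \<one> g" for m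
      proof -
        have "inv (g \<otimes> (b \<otimes> m0)) \<otimes> (g \<otimes> (b \<otimes> m)) = inv m0 \<otimes> m"
          using x m(1) m0(1) hg by (simp add: inv_mult_group m_assoc cancel)
        moreover have "b \<otimes> (inv b \<otimes> inv m0 \<otimes> m) = inv m0 \<otimes> m"
          using x m(1) m0(1) by (simp flip: m_assoc)
        ultimately show ?thesis
          using commute_inv_mult[of "g \<otimes> (b \<otimes> m0)" "g \<otimes> (b \<otimes> m)" a] x m m0 hg
          by (simp add: E_iff)
      qed
      then show ?thesis
        using x m0(1) by (intro bexI[of _ "(\<one>, inv b \<otimes> inv m0)"]) auto
    next
      case False
      then show ?thesis using x by (intro bexI[of _ "(\<one>, \<one>)"]) auto
    qed
  qed (use E hg in auto)
  also have "E \<one> \<one> = {p \<in> N \<times> N. commutator G (fst p) (snd p) = \<one>}"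
    unfolding E_def by auto
  finally show ?thesis unfolding E_def .
qed

lemma rel_comm_degree_eq:
  "rel_comm_degree G H L \<mu> = measure \<mu> {p \<in> H \<times> L. commutator G (fst p) (snd p) = \<one>\<^bsub>G\<^esub>}"
proof -
  have "{(h, l). h \<in> H \<and> l \<in> L \<and> commutator G h l = \<one>\<^bsub>G\<^esub>}
      = {p \<in> H \<times> L. commutator G (fst p) (snd p) = \<one>\<^bsub>G\<^esub>}"
    by (simp add: set_eq_iff)
  then show ?thesis by (simp add: rel_comm_degree_def)
qed

theorem theorem2p11:
  fixes G :: "('a, 'b) monoid_scheme" and T :: "'a topology"
    and H N :: "'a set"
    and \<mu>HG :: "('a \<times> 'a) measure"
    and \<mu>Q :: "('a set \<times> 'a set) measure"
    and \<mu>N :: "('a \<times> 'a) measure"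
  defines "TQ \<equiv> quot_topology T (\<lambda>x. N #>\<^bsub>G\<^esub> x)"
    and "HN \<equiv> (\<lambda>h. N #>\<^bsub>G\<^esub> h) ` H"
  assumes G: "compact_group G T"
    and H: "subgroup H G" "closedin T H"
    and N: "normal N G" "closedin T N" "N \<subseteq> H"
    and \<mu>HG: "normalized_haar (G\<lparr>carrier := H\<rparr> \<times>\<times> G) (prod_topology (subtopology T H) T) \<mu>HG"
    and \<mu>Q: "normalized_haar ((G Mod N)\<lparr>carrier := HN\<rparr> \<times>\<times> (G Mod N))
                (prod_topology (subtopology TQ HN) TQ) \<mu>Q"
    and \<mu>N: "normalized_haar (G\<lparr>carrier := N\<rparr> \<times>\<times> G\<lparr>carrier := N\<rparr>)
                (prod_topology (subtopology T N) (subtopology T N)) \<mu>N"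
  shows "rel_comm_degree G H (carrier G) \<mu>HG
           \<le> rel_comm_degree (G Mod N) HN (carrier (G Mod N)) \<mu>Q * rel_comm_degree G N N \<mu>N
         \<and> (N \<inter> commutator_subgroup G H (carrier G) = {\<one>\<^bsub>G\<^esub>} \<longrightarrow>
              rel_comm_degree G H (carrier G) \<mu>HG
                = rel_comm_degree (G Mod N) HN (carrier (G Mod N)) \<mu>Q * rel_comm_degree G N N \<mu>N)"
proof -
  note top = compact_groupD[OF G]
  interpret group G by (rule top(1))
  interpret H: subgroup H G by (rule H(1))
  interpret N: normal N G by (rule N(1))
  let ?p = "\<lambda>x. N #>\<^bsub>G\<^esub> x"
  let ?GQ = "G Mod N"
  let ?P = "G\<lparr>carrier := H\<rparr> \<times>\<times> G" and ?TP = "prod_topology (subtopology T H) T"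
  let ?Q = "?GQ\<lparr>carrier := HN\<rparr> \<times>\<times> ?GQ" and ?TQ = "prod_topology (subtopology TQ HN) TQ"
  let ?K = "G\<lparr>carrier := N\<rparr> \<times>\<times> G\<lparr>carrier := N\<rparr>"
  let ?TK = "prod_topology (subtopology T N) (subtopology T N)"
  let ?q = "\<lambda>x. (?p (fst x), ?p (snd x))"

  \<comment> \<open>The compact groups \<open>H \<times> G\<close>, \<open>N \<times> N\<close> and
    \<open>H/N \<times> G/N\<close>\<close>
  have NG: "subgroup N G" by (rule N.subgroup_axioms)
  have GQ: "compact_group ?GQ TQ" unfolding TQ_def by (rule compact_group_FactGroup[OF G N(1,2)])
  have cp: "continuous_map T TQ ?p" unfolding TQ_def by (rule continuous_map_quot_topology)
  have HN: "subgroup HN ?GQ"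
  proof -
    interpret group_hom G ?GQ ?p
      by (intro group_hom.intro group_hom_axioms.intro group_axioms N.factorgroup_is_group
          N.r_coset_hom_Mod)
    show ?thesis unfolding HN_def by (rule subgroup_img_is_subgroup[OF H(1)])
  qed
  have clHN: "closedin TQ HN"
    unfolding HN_def
    using closedin_compact_space[OF top(5) H(2)] compact_groupD(6)[OF GQ] image_compactin[OF _ cp]
      compactin_imp_closedin by blast
  have P: "compact_group ?P ?TP"
    by (intro compact_group_DirProd compact_group_subgroup G H)
  have K: "compact_group ?K ?TK"
    by (intro compact_group_DirProd compact_group_subgroup G N NG)
  have Q: "compact_group ?Q ?TQ"
    by (intro compact_group_DirProd compact_group_subgroup GQ HN clHN)
  have tP: "topspace ?TP = H \<times> carrier G" and tK: "topspace ?TK = N \<times> N"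
    and tQ: "topspace ?TQ = HN \<times> carrier ?GQ"
    using compact_groupD(2)[OF P] compact_groupD(2)[OF K] compact_groupD(2)[OF Q] by auto
  note bpP = normalized_haar_borel_prob[OF \<mu>HG] and bpQ = normalized_haar_borel_prob[OF \<mu>Q]
    and bpK = normalized_haar_borel_prob[OF \<mu>N]
  note hiP = normalized_haar_integral[OF P \<mu>HG] and hiQ = normalized_haar_integral[OF Q \<mu>Q]

  \<comment> \<open>The projection onto the quotient and its effect on integrals\<close>
  have cP: "continuous_map ?TP T fst" "continuous_map ?TP T snd"
    using continuous_map_fst[of "subtopology T H" T] continuous_map_snd[of "subtopology T H" T]
    by (auto dest: continuous_map_into_fulltopology)
  have cQ: "continuous_map ?TQ TQ fst" "continuous_map ?TQ TQ snd"
    using continuous_map_fst[of "subtopology TQ HN" TQ] continuous_map_snd[of "subtopology TQ HN" TQ]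
    by (auto dest: continuous_map_into_fulltopology)
  have cq: "continuous_map ?TP ?TQ ?q"
  proof (rule continuous_map_pairedI)
    show "continuous_map ?TP TQ (\<lambda>x. ?p (snd x))"
      using continuous_map_compose[OF cP(2) cp] by (simp add: o_def)
    show "continuous_map ?TP (subtopology TQ HN) (\<lambda>x. ?p (fst x))"
      using continuous_map_compose[OF cP(1) cp] tP
      by (auto simp: continuous_map_in_subtopology o_def HN_def)
  qed
  have q_hom: "?q \<in> hom ?P ?Q"
    by (auto simp: hom_def HN_def carrier_FactGroup N.rcos_sum)
  have q_surj: "?q ` carrier ?P = carrier ?Q"
    by (force simp: HN_def carrier_FactGroup)
  \<comment> \<open>\<open>\<mu>HG\<close> and \<open>\<mu>Q\<close> are given independently;
    uniqueness of the invariant integral on \<open>?Q\<close> is what ties them together.\<close>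
  have push: "(\<integral>x. f (?q x) \<partial>\<mu>HG) = (\<integral>y. f y \<partial>\<mu>Q)" if "continuous_map ?TQ euclideanreal f" for f
    by (rule haar_integral_hom_image[OF P hiP Q hiQ q_hom q_surj cq that])

  \<comment> \<open>Commuting pairs and right multiplication by \<open>N \<times> N\<close>\<close>
  define C where "C = {x \<in> H \<times> carrier G. commutator G (fst x) (snd x) = \<one>\<^bsub>G\<^esub>}"
  define CQ where "CQ = {y \<in> HN \<times> carrier ?GQ. commutator ?GQ (fst y) (snd y) = \<one>\<^bsub>?GQ\<^esub>}"
  define CN where "CN = {k \<in> N \<times> N. commutator G (fst k) (snd k) = \<one>\<^bsub>G\<^esub>}"
  have dP: "rel_comm_degree G H (carrier G) \<mu>HG = measure \<mu>HG C"
    and dQ: "rel_comm_degree ?GQ HN (carrier ?GQ) \<mu>Q = measure \<mu>Q CQ"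
    and dN: "rel_comm_degree G N N \<mu>N = measure \<mu>N CN"
    unfolding C_def CQ_def CN_def by (rule rel_comm_degree_eq)+
  have clC: "closedin ?TP C"
    using closedin_commuting[OF G cP] unfolding tP C_def .
  have clCQ: "closedin ?TQ CQ"
    using closedin_commuting[OF GQ cQ] unfolding tQ CQ_def .
  have CQ_iff: "?q x \<in> CQ \<longleftrightarrow> commutator G (fst x) (snd x) \<in> N" if "x \<in> H \<times> carrier G" for x
    using that N.commutator_FactGroup_eq_one_iff[of "fst x" "snd x"]
    by (auto simp: CQ_def HN_def carrier_FactGroup)
  have CN_le_1: "measure \<mu>N CN \<le> 1"
    using finite_measure.bounded_measure[OF borel_prob_finite[OF bpK], of CN] bpK
    by (simp add: borel_prob_def measure_def)
  let ?\<theta> = "\<lambda>x k. x \<otimes>\<^bsub>?P\<^esub> k"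
  have KP: "k \<in> carrier ?P" if "k \<in> topspace ?TK" for k
    using that tK N(3) by auto
  have \<theta>: "continuous_map (prod_topology ?TP ?TK) ?TP (\<lambda>(x, k). ?\<theta> x k)"
  proof -
    have fst: "continuous_map ?TK T fst" and snd: "continuous_map ?TK T snd"
      using continuous_map_fst[of "subtopology T N" "subtopology T N"]
        continuous_map_snd[of "subtopology T N" "subtopology T N"]
      by (auto dest: continuous_map_into_fulltopology)
    have "continuous_map ?TK (subtopology T H) fst"
    proof (rule continuous_map_into_subtopology[OF fst])
      show "fst \<in> topspace ?TK \<rightarrow> H"
        unfolding tK by (rule funcsetI) (use N(3) in \<open>simp add: mem_Times_iff subset_iff\<close>)
    qed
    from continuous_map_pairedI[OF this snd] have "continuous_map ?TK ?TP (\<lambda>k. k)" by simp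
    then have "continuous_map (prod_topology ?TP ?TK) ?TP (\<lambda>z. snd z)"
      using continuous_map_compose[OF continuous_map_snd[of ?TP ?TK]] by (simp add: o_def)
    then show ?thesis
      using continuous_map_group_mult[OF P continuous_map_fst[of ?TP ?TK]] by (simp add: case_prod_unfold)
  qed

  \<comment> \<open>The upper bound for the measure of the commuting pairs\<close>
  have le: "measure \<mu>HG C \<le> measure \<mu>Q CQ * measure \<mu>N CN"
  proof (rule field_le_epsilon)
    fix e :: real assume e: "e > 0"
    \<comment> \<open>The function \<open>f\<close> obtained from \<open>U\<close> stands in for the
      indicator of \<open>CQ\<close>, so that \<open>measure \<mu>N CN * f (?q x)\<close> is a
      continuous bound for the measure of the fibre over \<open>x\<close>.\<close>
    obtain U where U: "openin ?TQ U" "CQ \<subseteq> U" "measure \<mu>Q U < measure \<mu>Q CQ + e"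
      using outer_regularE[OF normalized_haar_outer_regular[OF \<mu>Q] bpQ borel_prob_closedin[OF bpQ clCQ] e]
      by blast
    have cl: "closedin ?TQ (topspace ?TQ - U)"
      by (intro closedin_diff closedin_topspace U(1))
    have dj: "disjnt CQ (topspace ?TQ - U)"
      using U(2) unfolding disjnt_def by blast
    obtain f where f: "continuous_map ?TQ euclideanreal f"
      "\<forall>y\<in>topspace ?TQ. 0 \<le> f y" "\<forall>y\<in>topspace ?TQ. f y \<le> 1"
      "\<forall>y\<in>CQ. f y = 1" "\<forall>y\<in>topspace ?TQ - U. f y = 0"
      using Urysohn_compact_Hausdorff[OF compact_groupD(5,6)[OF Q] clCQ cl dj] by blast
    have fq: "continuous_map ?TP euclideanreal (\<lambda>x. f (?q x))"
      using continuous_map_compose[OF cq f(1)] by (simp add: o_def)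
    have "measure \<mu>HG C \<le> (\<integral>x. measure \<mu>N CN * f (?q x) \<partial>\<mu>HG)"
    proof (rule measure_le_integral_average[OF compact_groupD(5,6)[OF P] bpP compact_groupD(5)[OF K]
          bpK normalized_haar_outer_regular[OF \<mu>N] \<theta> _ clC])
      show "(\<integral>x. h (?\<theta> x k) \<partial>\<mu>HG) = (\<integral>x. h x \<partial>\<mu>HG)"
        if "continuous_map ?TP euclideanreal h" "k \<in> topspace ?TK" for h k
        by (rule haar_integral_right[OF P hiP that(1) KP[OF that(2)]])
      show "continuous_map ?TP euclideanreal (\<lambda>x. measure \<mu>N CN * f (?q x))"
        by (intro continuous_map_real_mult fq) auto
      fix x assume "x \<in> topspace ?TP"
      then obtain h g where x: "x = (h, g)" "h \<in> H" "g \<in> carrier G" using tP by auto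
      let ?S = "{k \<in> topspace ?TK. ?\<theta> x k \<in> C}"
      have qx: "?q x \<in> topspace ?TQ"
        using x tQ by (auto simp: HN_def carrier_FactGroup)
      have S: "?S = {k \<in> N \<times> N. commutator G (h \<otimes>\<^bsub>G\<^esub> fst k) (g \<otimes>\<^bsub>G\<^esub> snd k) = \<one>\<^bsub>G\<^esub>}"
        unfolding tK
      proof (intro Collect_cong conj_cong refl)
        fix k assume "k \<in> N \<times> N"
        then have "fst k \<in> H" "snd k \<in> carrier G"
          using N(3) by (simp_all add: mem_Times_iff subset_iff)
        then show "?\<theta> x k \<in> C \<longleftrightarrow> commutator G (h \<otimes>\<^bsub>G\<^esub> fst k) (g \<otimes>\<^bsub>G\<^esub> snd k) = \<one>\<^bsub>G\<^esub>"
          using x by (simp add: C_def DirProd_def case_prod_unfold)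
      qed
      show "measure \<mu>N ?S \<le> measure \<mu>N CN * f (?q x)"
      \<comment> \<open>A point of the fibre gives a commuting pair that agrees with
        \<open>x\<close> modulo \<open>N\<close>, which forces \<open>?q x\<close> into
        \<open>CQ\<close>, where \<open>f\<close> is one. An empty fibre only needs \<open>f\<close>
        to be non-negative.\<close>
      proof (cases "?S = {}")
        case True
        have "0 \<le> f (?q x)" using f(2) qx by blast
        then show ?thesis unfolding True by simp
      next
        case False
        then obtain n m where nm: "n \<in> N" "m \<in> N"
          "commutator G (h \<otimes>\<^bsub>G\<^esub> n) (g \<otimes>\<^bsub>G\<^esub> m) = \<one>\<^bsub>G\<^esub>" unfolding S by auto
        have "?p (h \<otimes>\<^bsub>G\<^esub> n) = ?p h" "?p (g \<otimes>\<^bsub>G\<^esub> m) = ?p g"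
          using nm x N.inv_op_closed2 by (auto simp: N.r_coset_eq_iff)
        then have "?q (h \<otimes>\<^bsub>G\<^esub> n, g \<otimes>\<^bsub>G\<^esub> m) = ?q x" using x by simp
        moreover have "?q (h \<otimes>\<^bsub>G\<^esub> n, g \<otimes>\<^bsub>G\<^esub> m) \<in> CQ"
          using CQ_iff[of "(h \<otimes>\<^bsub>G\<^esub> n, g \<otimes>\<^bsub>G\<^esub> m)"] nm x N(3) by (simp add: subset_iff)
        ultimately have "?q x \<in> CQ" by simp
        then have "f (?q x) = 1" using f(4) by blast
        moreover have "measure \<mu>N ?S \<le> measure \<mu>N CN"
          unfolding S CN_def using x
          by (intro measure_commuting_translates_le[OF G NG N(2) \<mu>N]) auto
        ultimately show ?thesis by simp
      qed
    qed
    also have "\<dots> = measure \<mu>N CN * (\<integral>y. f y \<partial>\<mu>Q)" using push[OF f(1)] by simp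
    also have "\<dots> \<le> measure \<mu>N CN * (measure \<mu>Q CQ + e)"
    proof (rule mult_left_mono)
      have "(\<integral>y. f y \<partial>\<mu>Q) \<le> measure \<mu>Q U"
        using f borel_prob_openin[OF bpQ U(1)]
        by (intro integral_le_measure[OF compact_groupD(5)[OF Q] bpQ]) auto
      then show "(\<integral>y. f y \<partial>\<mu>Q) \<le> measure \<mu>Q CQ + e" using U(3) by simp
    qed simp
    \<comment> \<open>The factor \<open>measure \<mu>N CN\<close> is at most one, so it does not
      enlarge the error \<open>e\<close>.\<close>
    also have "\<dots> \<le> measure \<mu>Q CQ * measure \<mu>N CN + e"
      using mult_right_mono[OF CN_le_1, of e] e by (simp add: algebra_simps)
    finally show "measure \<mu>HG C \<le> measure \<mu>Q CQ * measure \<mu>N CN + e" .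
  qed

  \<comment> \<open>The reverse inequality when \<open>N\<close> meets \<open>[H,G]\<close>
    trivially\<close>
  have ge: "measure \<mu>Q CQ * measure \<mu>N CN \<le> measure \<mu>HG C"
    if triv: "N \<inter> commutator_subgroup G H (carrier G) = {\<one>\<^bsub>G\<^esub>}"
  proof -
    have comm: "commutator G h g = \<one>\<^bsub>G\<^esub>"
      if "h \<in> H" "g \<in> carrier G" "commutator G h g \<in> N" for h g
    proof -
      have "commutator G h g \<in> commutator_subgroup G H (carrier G)"
        unfolding commutator_subgroup_def using that by (intro generate.incl) auto
      then show ?thesis using triv that by blast
    qed
    have "measure \<mu>Q CQ \<le> measure \<mu>HG C"
    proof (rule field_le_epsilon)
      fix e :: real assume e: "e > 0"
      obtain U where U: "openin ?TP U" "C \<subseteq> U" "measure \<mu>HG U < measure \<mu>HG C + e"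
        using outer_regularE[OF normalized_haar_outer_regular[OF \<mu>HG] bpP borel_prob_closedin[OF bpP clC] e]
        by blast
      \<comment> \<open>Under \<open>triv\<close> every pair projecting into \<open>CQ\<close>
        commutes and so lies in \<open>C \<subseteq> U\<close>. Hence the image of the complement of
        \<open>U\<close> is a closed set missing \<open>CQ\<close>, and a Urysohn function vanishing
        on it pulls back along \<open>?q\<close> to one vanishing off \<open>U\<close>.\<close>
      have "compactin ?TP (topspace ?TP - U)"
        by (intro closedin_compact_space[OF compact_groupD(5)[OF P]] closedin_diff closedin_topspace U(1))
      then have cl: "closedin ?TQ (?q ` (topspace ?TP - U))"
        using image_compactin[OF _ cq] compactin_imp_closedin[OF compact_groupD(6)[OF Q]] by blast
      have dj: "disjnt CQ (?q ` (topspace ?TP - U))"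
      proof -
        have "x \<in> U" if "x \<in> topspace ?TP" "?q x \<in> CQ" for x
          using that U(2) comm CQ_iff tP unfolding C_def by auto
        then show ?thesis by (auto simp: disjnt_iff)
      qed
      obtain f where f: "continuous_map ?TQ euclideanreal f"
        "\<forall>y\<in>topspace ?TQ. 0 \<le> f y" "\<forall>y\<in>topspace ?TQ. f y \<le> 1"
        "\<forall>y\<in>CQ. f y = 1" "\<forall>y\<in>?q ` (topspace ?TP - U). f y = 0"
        using Urysohn_compact_Hausdorff[OF compact_groupD(5,6)[OF Q] clCQ cl dj] by blast
      have "measure \<mu>Q CQ \<le> (\<integral>y. f y \<partial>\<mu>Q)"
        using f borel_prob_closedin[OF bpQ clCQ]
        by (intro measure_le_integral[OF compact_groupD(5)[OF Q] bpQ]) auto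
      also have "\<dots> = (\<integral>x. f (?q x) \<partial>\<mu>HG)" using push[OF f(1)] by simp
      also have "\<dots> \<le> measure \<mu>HG U"
      proof (rule integral_le_measure[OF compact_groupD(5)[OF P] bpP _ borel_prob_openin[OF bpP U(1)]])
        show "continuous_map ?TP euclideanreal (\<lambda>x. f (?q x))"
          using continuous_map_compose[OF cq f(1)] by (simp add: o_def)
        show "f (?q x) \<le> 1" if "x \<in> topspace ?TP" for x
          using f(3) continuous_map_funspace[OF cq] that by blast
        show "f (?q x) \<le> 0" if "x \<in> topspace ?TP - U" for x
        proof -
          have "f (?q x) = 0" using f(5) that by blast
          then show ?thesis by simp
        qed
      qed
      finally show "measure \<mu>Q CQ \<le> measure \<mu>HG C + e" using U(3) by simp
    qed
    then show ?thesis
      using mult_left_mono[OF CN_le_1, of "measure \<mu>Q CQ"] by simp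
  qed
  show ?thesis unfolding dP dQ dN using le ge by (auto intro: antisym)
qed

end
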